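(* Let $p\in(0,1)$, and let $(\mathcal{G}_x)_{x\in\mathbb{Z}^2}$ be i.i.d. with $\mathcal{G}_x=\{e_1,-e_1,-e_2\}$ with probability $p$ and $\mathcal{G}_x=\{e_1\}$ with probability $1-p$. Put $\gamma=\frac{3+\sqrt5}{2}$ and $\Theta(z)=\sum_{n=0}^\infty \frac{z^n}{\gamma^{2n+1}+1}$ for $|z|<\gamma^2$. Then the random walk $(X_n)$ in the associated uniform random environment, started at the origin, satisfies $P(n^{-1}X_n\to v)=1$ for a deterministic $v=(v^{[1]},v^{[2]})$ with $v^{[2]}\neq0$, $$-\frac{1}{v^{[2]}}=4-p-\frac{5+\sqrt5}{2}(1-p)^2\,\Theta(p\gamma)+\frac{(1-p)\big[3+\sqrt5-(1-p)(5+\sqrt5)\,\Theta(p)\big]^2}{(3+\sqrt5)\big[2-(1-p)(5+\sqrt5)\,\Theta(p\gamma)\big]},$$ and $v^{[1]}=1+3v^{[2]}$.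
   Context: $e_1=(1,0)$ and $e_2=(0,1)$ are the unit vectors of $\mathbb{Z}^2$. Given a realization of the i.i.d. non-empty sets $(\mathcal{G}_x)_{x\in\mathbb{Z}^2}$, each a subset of $\{\pm e_1,\pm e_2\}$, the walk in the associated uniform random environment is the time-homogeneous Markov chain $(X_n)_{n\ge0}$ on $\mathbb{Z}^2$ with $X_0=0$ that moves from $x$ to $x+e$ with probability $1/|\mathcal{G}_x|$ if $e\in\mathcal{G}_x$, and with probability $0$ otherwise. The environment is sampled once and kept fixed. $P$ denotes the annealed law, i.e. the law of the walk averaged over the environment. *)

theory Defs
  imports "HOL-Probability.Probability"
begin

section \<open>Walks in uniform random environments\<close>

type_synonym site = "int \<times> int"

definition e1 :: site where "e1 = (1, 0)"

definition e2 :: site where "e2 = (0, 1)"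

abbreviation env_space :: "(site \<Rightarrow> site set) measure" where
  "env_space \<equiv> PiM UNIV (\<lambda>_. count_space UNIV)"

abbreviation path_space :: "(nat \<Rightarrow> site) measure" where
  "path_space \<equiv> PiM UNIV (\<lambda>_. count_space UNIV)"

text \<open>
  Meaningful when the set of allowed steps at \<open>x\<close> is finite and non-empty; see \<open>pmf_walk_step\<close>.
\<close>
definition walk_step :: "(site \<Rightarrow> site set) \<Rightarrow> site \<Rightarrow> site pmf" where
  "walk_step G x = map_pmf (\<lambda>e. x + e) (pmf_of_set (G x))"

lemma pmf_walk_step:
  assumes "finite (G x)" "G x \<noteq> {}"
  shows "pmf (walk_step G x) (x + e) = (if e \<in> G x then 1 / real (card (G x)) else 0)"
proof -
  have "pmf (walk_step G x) (x + e) = pmf (pmf_of_set (G x)) e"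
    unfolding walk_step_def by (intro pmf_map_inj') (auto intro!: injI)
  then show ?thesis
    using assms by (simp add: indicator_def)
qed

text \<open>
  The law of \<open>X\<^sub>i\<close> given \<open>X\<^sub>0, \<dots>, X\<^sub>i\<^sub>-\<^sub>1\<close>, in the form needed for the Ionescu-Tulcea construction.
\<close>
definition walk_kernel :: "(site \<Rightarrow> site set) \<Rightarrow> nat \<Rightarrow> (nat \<Rightarrow> site) \<Rightarrow> site pmf" where
  "walk_kernel G i X = (case i of 0 \<Rightarrow> return_pmf 0 | Suc j \<Rightarrow> walk_step G (X j))"

lemma Ionescu_Tulcea_walk:
  "Ionescu_Tulcea (\<lambda>i X. measure_pmf (walk_kernel G i X)) (\<lambda>_. count_space UNIV)"
proof
  fix i :: nat
  show "(\<lambda>X. measure_pmf (walk_kernel G i X))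
          \<in> PiM {0..<i} (\<lambda>_. count_space UNIV) \<rightarrow>\<^sub>M subprob_algebra (count_space UNIV)"
  proof (cases i)
    case (Suc j)
    have "(\<lambda>X. X j) \<in> PiM {0..<i} (\<lambda>_. count_space (UNIV :: site set)) \<rightarrow>\<^sub>M count_space UNIV"
      using Suc by (intro measurable_component_singleton) auto
    moreover have "(\<lambda>y. measure_pmf (walk_step G y))
        \<in> count_space UNIV \<rightarrow>\<^sub>M subprob_algebra (count_space UNIV)"
      by (auto simp: space_subprob_algebra intro!: prob_space_imp_subprob_space measure_pmf.prob_space_axioms)
    ultimately show ?thesis
      by (auto simp: walk_kernel_def Suc intro: measurable_compose)
  next
    case 0
    then show ?thesis
      by (simp add: walk_kernel_def space_subprob_algebra measure_pmf.subprob_space_axioms)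
  qed
qed

text \<open>
  The law of the walk in the fixed environment \<open>G\<close>: the projective limit of the finite-dimensional
  distributions provided by the Ionescu-Tulcea theorem.  It is characterised by
  \<open>emeasure_quenched_cylinder\<close>.
\<close>
definition quenched_law :: "(site \<Rightarrow> site set) \<Rightarrow> (nat \<Rightarrow> site) measure" where
  "quenched_law G = projective_family.lim UNIV
     (Ionescu_Tulcea.CI (\<lambda>i X. measure_pmf (walk_kernel G i X)) (\<lambda>_. count_space UNIV))
     (\<lambda>_. count_space UNIV)"

lemma sets_quenched_law [simp, measurable_cong]: "sets (quenched_law G) = sets path_space"
proof -
  interpret IT: Ionescu_Tulcea "\<lambda>i X. measure_pmf (walk_kernel G i X)" "\<lambda>_. count_space UNIV"
    by (rule Ionescu_Tulcea_walk)
  show ?thesis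
    unfolding quenched_law_def by simp
qed

lemma prob_space_quenched_law: "prob_space (quenched_law G)"
proof -
  interpret IT: Ionescu_Tulcea "\<lambda>i X. measure_pmf (walk_kernel G i X)" "\<lambda>_. count_space UNIV"
    by (rule Ionescu_Tulcea_walk)
  have "distr (quenched_law G) (PiM {} (\<lambda>_. count_space UNIV)) (\<lambda>x. restrict x {}) = IT.CI {}"
    unfolding quenched_law_def by (rule IT.distr_lim) simp
  moreover have "prob_space (IT.CI {})"
    by (rule IT.PF.prob_space_P) auto
  moreover have "(\<lambda>x. restrict x {}) \<in> quenched_law G \<rightarrow>\<^sub>M PiM {} (\<lambda>_. count_space (UNIV :: site set))"
    by (simp add: measurable_restrict measurable_cong_sets[OF sets_quenched_law refl] measurable_restrict_subset)
  ultimately show ?thesis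
    by (metis prob_space_distrD)
qed

lemma emeasure_quenched_cylinder_kernel:
  "emeasure (quenched_law G) {X. \<forall>i<n. X i = x i} = (\<Prod>i<n. ennreal (pmf (walk_kernel G i x) (x i)))"
proof -
  interpret IT: Ionescu_Tulcea "\<lambda>i X. measure_pmf (walk_kernel G i X)" "\<lambda>_. count_space UNIV"
    by (rule Ionescu_Tulcea_walk)
  let ?u = "\<lambda>_. undefined :: site"
  let ?P = "\<lambda>n. PiM {0..<n} (\<lambda>_. count_space (UNIV :: site set))"
  let ?r = "\<lambda>n. restrict x {0..<n}"
  have r_eq: "{?r n} = PiE {0..<n} (\<lambda>i. {x i})" for n
    by (auto simp: PiE_iff extensional_def fun_eq_iff)
  have r_sets [measurable]: "{?r n} \<in> sets (?P n)" for n
    unfolding r_eq by (intro sets_PiM_I_finite) auto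
  have u: "?u \<in> space (?P 0)"
    by (auto simp: space_PiM PiE_iff extensional_def)
  have C: "emeasure (IT.C 0 n ?u) {?r n} = (\<Prod>i<n. ennreal (pmf (walk_kernel G i x) (x i)))" for n
  proof (induction n)
    case 0
    have "?r 0 = ?u" by auto
    moreover have "emeasure (return (?P 0) ?u) {?r 0} = indicator {?r 0} ?u"
      by (rule emeasure_return) (rule r_sets)
    ultimately show ?case
      by simp
  next
    case (Suc n)
    have sp: "space (IT.C 0 n ?u) = space (?P n)"
      using IT.space_C[OF u, of n] by simp
    have st: "sets (IT.C 0 n ?u) = sets (?P n)"
      using IT.sets_C[OF u, of n] by simp
    have ep: "IT.eP n \<omega> {?r (Suc n)} = ennreal (pmf (walk_kernel G n x) (x n)) * indicator {?r n} \<omega>"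
      if \<omega>: "\<omega> \<in> space (?P n)" for \<omega>
    proof -
      have ext: "\<omega> \<in> extensional {0..<n}"
        using \<omega> by (auto simp: space_PiM PiE_def)
      have "(\<lambda>y. fun_upd \<omega> n y) -` {?r (Suc n)} \<inter> UNIV = (if \<omega> = ?r n then {x n} else {})"
      proof (cases "\<omega> = ?r n")
        case True
        then have "?r (Suc n) = fun_upd \<omega> n (x n)"
          by (auto simp: fun_eq_iff)
        then have "fun_upd \<omega> n y = ?r (Suc n) \<longleftrightarrow> y = x n" for y
          by (metis fun_upd_same)
        with True show ?thesis
          by auto
      next
        case False
        have "fun_upd \<omega> n y \<noteq> ?r (Suc n)" for y
        proof
          assume "fun_upd \<omega> n y = ?r (Suc n)"
          then have *: "(fun_upd \<omega> n y) i = ?r (Suc n) i" for i by simp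
          have "\<omega> i = ?r n i" for i
            using *[of i] ext by (cases "i < n") (auto simp: extensional_def)
          with False show False by auto
        qed
        with False show ?thesis by auto
      qed
      moreover have "walk_kernel G n (?r n) = walk_kernel G n x"
        by (auto simp: walk_kernel_def split: nat.split)
      ultimately show ?thesis
        using IT.emeasure_eP[OF \<omega> r_sets[of "Suc n"]]
        by (auto simp: emeasure_pmf_single indicator_def)
    qed
    have "emeasure (IT.C 0 (Suc n) ?u) {?r (Suc n)} = (\<integral>\<^sup>+ \<omega>. IT.eP n \<omega> {?r (Suc n)} \<partial>IT.C 0 n ?u)"
    proof -
      have "IT.eP n \<in> IT.C 0 n ?u \<rightarrow>\<^sub>M subprob_algebra (?P (Suc n))"
        using IT.measurable_eP[of n] by (simp add: measurable_cong_sets[OF st refl])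
      moreover have "space (IT.C 0 n ?u) \<noteq> {}"
        unfolding sp by (auto simp: space_PiM_empty_iff)
      ultimately show ?thesis
        using r_sets[of "Suc n"] by (simp add: emeasure_bind)
    qed
    also have "\<dots> = (\<integral>\<^sup>+ \<omega>. ennreal (pmf (walk_kernel G n x) (x n)) * indicator {?r n} \<omega> \<partial>IT.C 0 n ?u)"
      by (intro nn_integral_cong ep) (simp add: sp)
    also have "\<dots> = ennreal (pmf (walk_kernel G n x) (x n)) * emeasure (IT.C 0 n ?u) {?r n}"
      using r_sets[of n] st by (intro nn_integral_cmult_indicator) simp
    finally show ?case
      by (simp only: Suc.IH prod.lessThan_Suc mult.commute)
  qed
  have emb: "{X. \<forall>i<n. X i = x i} = prod_emb UNIV (\<lambda>_. count_space UNIV) {0..<n} {?r n}"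
    unfolding r_eq by (auto simp: prod_emb_def PiE_iff)
  have "emeasure (quenched_law G) {X. \<forall>i<n. X i = x i} = emeasure (IT.CI {0..<n}) {?r n}"
    unfolding emb quenched_law_def by (rule IT.lim) auto
  also have "\<dots> = emeasure (IT.C 0 n ?u) (prod_emb {0..<n} (\<lambda>_. count_space UNIV) {0..<n} {?r n})"
    by (rule IT.emeasure_CI) auto
  also have "prod_emb {0..<n} (\<lambda>_. count_space UNIV) {0..<n} {?r n} = {?r n}"
    by (rule prod_emb_id) (auto simp: r_eq[symmetric])
  finally show ?thesis
    by (simp add: C)
qed

lemma emeasure_quenched_cylinder:
  "emeasure (quenched_law G) {X. \<forall>i\<le>n. X i = x i} =
     (if x 0 = 0 then \<Prod>i<n. ennreal (pmf (walk_step G (x i)) (x (Suc i))) else 0)"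
proof -
  have "emeasure (quenched_law G) {X. \<forall>i\<le>n. X i = x i} =
      (\<Prod>i<Suc n. ennreal (pmf (walk_kernel G i x) (x i)))"
    using emeasure_quenched_cylinder_kernel[of G "Suc n" x] by (simp only: less_Suc_eq_le)
  then show ?thesis
    by (simp add: prod.lessThan_Suc_shift walk_kernel_def del: prod.lessThan_Suc)
qed

lemma measurable_quenched_law [measurable]:
  "quenched_law \<in> env_space \<rightarrow>\<^sub>M prob_algebra path_space"
proof -
  let ?cyl = "\<lambda>xs :: site list. {X :: nat \<Rightarrow> site. \<forall>i<length xs. X i = xs ! i}"
  let ?G = "insert {} (range ?cyl)"
  have cyl_sets: "?cyl xs \<in> sets path_space" for xs
  proof -
    have "?cyl xs = (\<Inter>i<length xs. {X \<in> space path_space. X i \<in> {xs ! i}}) \<inter> space path_space"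
      by (auto simp: space_PiM)
    also have "\<dots> \<in> sets path_space"
      by (cases "length xs = 0") (auto intro!: sets.Int sets.finite_INT)
    finally show ?thesis .
  qed
  show ?thesis
  proof (rule measurable_prob_algebra_generated[where G = ?G and \<Omega> = UNIV])
    show "sets path_space = sigma_sets UNIV ?G"
    proof (rule antisym)
      show "sigma_sets UNIV ?G \<subseteq> sets path_space"
      proof -
        have "sigma_sets (space path_space) ?G \<subseteq> sets path_space"
          using cyl_sets by (intro sets.sigma_sets_subset) auto
        then show ?thesis by (simp add: space_PiM)
      qed
      show "sets path_space \<subseteq> sigma_sets UNIV ?G"
        unfolding sets_PiM_single
      proof (simp add: PiE_def, intro sigma_sets_mono, safe)
        fix i :: nat and A :: "site set"
        have "{X. X i \<in> A} = (\<Union>xs \<in> {xs. length xs = Suc i \<and> xs ! i \<in> A}. ?cyl xs)"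
        proof (intro equalityI subsetI)
          fix X :: "nat \<Rightarrow> site" assume "X \<in> {X. X i \<in> A}"
          then show "X \<in> (\<Union>xs \<in> {xs. length xs = Suc i \<and> xs ! i \<in> A}. ?cyl xs)"
            by (intro UN_I[of "map X [0..<Suc i]"]) (auto simp: nth_append simp del: upt_Suc)
        qed auto
        also have "\<dots> \<in> sigma_sets UNIV ?G"
        proof (rule sigma_sets_UNION)
          show "B \<in> sigma_sets UNIV ?G"
            if "B \<in> ?cyl ` {xs. length xs = Suc i \<and> xs ! i \<in> A}" for B
            using that by (intro sigma_sets.Basic) blast
        qed auto
        finally show "{X. X i \<in> A} \<in> sigma_sets UNIV ?G" .
      qed
    qed
    have comp: "?cyl xs \<inter> ?cyl ys \<in> ?G" if "length xs \<le> length ys" for xs ys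
    proof (cases "\<forall>i<length xs. xs ! i = ys ! i")
      case True
      then have "?cyl xs \<inter> ?cyl ys = ?cyl ys"
        using that by auto
      then show ?thesis by simp
    next
      case False
      then have "?cyl xs \<inter> ?cyl ys = {}"
        using that by auto
      then show ?thesis by simp
    qed
    show "Int_stable ?G"
    proof (rule Int_stableI)
      fix a b assume "a \<in> ?G" "b \<in> ?G"
      moreover have "?cyl xs \<inter> ?cyl ys \<in> ?G" for xs ys
        using comp[of xs ys] comp[of ys xs] by (cases "length xs \<le> length ys") (auto simp: Int_commute)
      ultimately show "a \<inter> b \<in> ?G"
        by (elim insertE rangeE) simp_all
    qed
    show "(\<lambda>G. emeasure (quenched_law G) A) \<in> borel_measurable env_space" if "A \<in> ?G" for A
    proof (cases "A = {}")
      case False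
      with that have "A \<in> range ?cyl" by simp
      then obtain xs where A: "A = ?cyl xs" by (rule rangeE)
      have K: "(\<lambda>G. ennreal (pmf (walk_kernel G i (\<lambda>j. xs ! j)) (xs ! i))) \<in> borel_measurable env_space" for i
      proof (cases i)
        case (Suc j)
        have "(\<lambda>G. ennreal (pmf (map_pmf ((+) (xs ! j)) (pmf_of_set (G (xs ! j)))) (xs ! i)))
            \<in> borel_measurable env_space"
          by (rule measurable_compose[OF measurable_component_singleton[of "xs ! j"]]) auto
        then show ?thesis
          by (simp add: Suc walk_kernel_def walk_step_def)
      qed (simp add: walk_kernel_def)
      show ?thesis
        unfolding A emeasure_quenched_cylinder_kernel by (intro borel_measurable_prod_ennreal K)
    qed simp
  qed (auto intro: prob_space_quenched_law)
qed

text \<open>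
  The law of the walk averaged over a random environment \<open>G\<close> defined on a probability space \<open>M\<close>.
\<close>
definition annealed_law :: "'a measure \<Rightarrow> (site \<Rightarrow> 'a \<Rightarrow> site set) \<Rightarrow> (nat \<Rightarrow> site) measure" where
  "annealed_law M G = M \<bind> (\<lambda>\<omega>. quenched_law (\<lambda>x. G x \<omega>))"

lemma annealed_law_properties:
  assumes "prob_space M" "\<And>x. G x \<in> M \<rightarrow>\<^sub>M count_space UNIV"
  shows prob_space_annealed_law: "prob_space (annealed_law M G)"
    and sets_annealed_law: "sets (annealed_law M G) = sets path_space"
    and emeasure_annealed_law: "A \<in> sets path_space \<Longrightarrow>
      emeasure (annealed_law M G) A = (\<integral>\<^sup>+ \<omega>. emeasure (quenched_law (\<lambda>x. G x \<omega>)) A \<partial>M)"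
proof -
  interpret prob_space M by fact
  have "(\<lambda>\<omega> x. G x \<omega>) \<in> M \<rightarrow>\<^sub>M env_space"
    using assms(2) by (intro measurable_PiM_single') auto
  then have Q: "(\<lambda>\<omega>. quenched_law (\<lambda>x. G x \<omega>)) \<in> M \<rightarrow>\<^sub>M subprob_algebra path_space"
    by (intro measurable_prob_algebraD measurable_compose[OF _ measurable_quenched_law])
  show "sets (annealed_law M G) = sets path_space"
    unfolding annealed_law_def by (intro sets_bind) (auto simp: not_empty)
  show "prob_space (annealed_law M G)"
    unfolding annealed_law_def
    by (rule prob_space_bind[OF _ Q]) (auto intro: prob_space_quenched_law)
  show "emeasure (annealed_law M G) A = (\<integral>\<^sup>+ \<omega>. emeasure (quenched_law (\<lambda>x. G x \<omega>)) A \<partial>M)"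
    if "A \<in> sets path_space"
    unfolding annealed_law_def using that by (intro emeasure_bind[OF _ Q]) (auto simp: not_empty)
qed

section \<open>The constants in the velocity formula\<close>

definition gam :: real where "gam = (3 + sqrt 5) / 2"

text \<open>Only meaningful for \<open>\<bar>z\<bar> < gam\<^sup>2\<close>, where the series converges (\<open>summable_Theta\<close>).\<close>
definition Theta :: "real \<Rightarrow> real" where
  "Theta z = (\<Sum>n. z ^ n / (gam ^ (2 * n + 1) + 1))"

lemma summable_Theta:
  assumes "\<bar>z\<bar> < gam\<^sup>2"
  shows "summable (\<lambda>n. z ^ n / (gam ^ (2 * n + 1) + 1))"
proof (rule summable_comparison_test')
  have g: "gam \<ge> 1" by (simp add: gam_def)
  show "summable (\<lambda>n. (\<bar>z\<bar> / gam\<^sup>2) ^ n)"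
    using assms g by (intro summable_geometric) (simp add: divide_less_eq)
  fix n :: nat
  have "gam ^ (2 * n) \<le> gam ^ (2 * n + 1) + 1"
    using power_increasing[OF _ g, of "2 * n" "2 * n + 1"] by simp
  moreover have "0 < gam ^ (2 * n)" using g by simp
  ultimately have "\<bar>z\<bar> ^ n / (gam ^ (2 * n + 1) + 1) \<le> \<bar>z\<bar> ^ n / gam ^ (2 * n)"
    by (intro divide_left_mono mult_pos_pos) auto
  moreover have "0 < gam ^ (2 * n + 1) + 1" using g by (simp add: add_pos_pos)
  ultimately show "norm (z ^ n / (gam ^ (2 * n + 1) + 1)) \<le> (\<bar>z\<bar> / gam\<^sup>2) ^ n"
    by (simp add: power_divide power_mult power_abs abs_divide)
qed

text \<open>The denominator in the velocity formula does not vanish.\<close>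
lemma velocity_denominator_pos:
  assumes "0 < p" "p < 1"
  shows "0 < 2 - (1 - p) * (5 + sqrt 5) * Theta (p * gam)"
proof -
  have g: "gam > 1" by (simp add: gam_def add_pos_nonneg)
  let ?f = "\<lambda>n. (p * gam) ^ n / (gam ^ (2 * n + 1) + 1)" and ?h = "\<lambda>n. p ^ n / (gam + 1)"
  have "gam < gam\<^sup>2" using g by (simp add: power2_eq_square)
  moreover have "p * gam < gam" using assms g by simp
  moreover have "0 < p * gam" using assms g by simp
  ultimately have "\<bar>p * gam\<bar> < gam\<^sup>2" by linarith
  then have f: "summable ?f"
    by (rule summable_Theta)
  have h: "?h sums (1 / (1 - p) / (gam + 1))"
    using assms by (intro sums_divide geometric_sums) auto
  have D: "0 < gam ^ (2 * n + 1) + 1" for n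
    using g by (simp add: add_pos_pos)
  have diff: "?h n - ?f n =
      p ^ n * ((gam ^ n - 1) * (gam ^ Suc n - 1)) / ((gam + 1) * (gam ^ (2 * n + 1) + 1))" for n
  proof -
    have sq: "gam ^ (2 * n + 1) = gam * (gam ^ n * gam ^ n)"
      by (simp add: power_add mult_2)
    have nz: "gam + 1 \<noteq> 0" "gam ^ (2 * n + 1) + 1 \<noteq> 0"
      using g D[of n] by linarith+
    have "?h n - ?f n =
        (p ^ n * (gam ^ (2 * n + 1) + 1) - (p * gam) ^ n * (gam + 1)) /
        ((gam + 1) * (gam ^ (2 * n + 1) + 1))"
      using nz by (rule diff_frac_eq)
    also have "p ^ n * (gam ^ (2 * n + 1) + 1) - (p * gam) ^ n * (gam + 1) =
        p ^ n * ((gam ^ n - 1) * (gam ^ Suc n - 1))"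
      unfolding sq by (simp add: power_mult_distrib algebra_simps)
    finally show ?thesis .
  qed
  have ge: "1 \<le> gam ^ n" for n
    using g by (intro one_le_power) simp
  have nonneg: "0 \<le> ?h n - ?f n" for n
    unfolding diff using assms g D[of n] ge[of n] ge[of "Suc n"]
    by (intro divide_nonneg_pos mult_nonneg_nonneg mult_pos_pos zero_le_power) auto
  have g2: "1 < gam ^ Suc 1" using g by (intro power_gt1)
  have pos: "0 < ?h 1 - ?f 1"
    unfolding diff using assms g D[of 1] g2
    by (intro divide_pos_pos mult_pos_pos zero_less_power) auto
  have "0 < (\<Sum>n. ?h n - ?f n)"
    by (rule suminf_pos2[where i = 1]) (use nonneg pos f h in \<open>auto intro: summable_diff sums_summable\<close>)
  also have "\<dots> = 1 / (1 - p) / (gam + 1) - Theta (p * gam)"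
    using suminf_diff[OF sums_summable[OF h] f] sums_unique[OF h] by (simp add: Theta_def)
  finally have "Theta (p * gam) < 1 / (1 - p) / (gam + 1)" by simp
  then have "(1 - p) * (gam + 1) * Theta (p * gam) < 1"
    using assms g by (simp add: pos_less_divide_eq mult_ac)
  moreover have "(1 - p) * (5 + sqrt 5) * Theta (p * gam) = 2 * ((1 - p) * (gam + 1) * Theta (p * gam))"
    by (simp add: gam_def field_simps)
  ultimately show ?thesis by linarith
qed

end

theory Submission
  imports Defs
begin

text \<open>
  The walk never moves up, so it sees each row only once: the times spent in successive rows are
  i.i.d., with some mean \<open>m\<close>, and \<open>v2 = - 1 / m\<close>.  Only one-time marginals are needed: the probability
  that the walk is at depth \<open>k\<close> at time \<open>n\<close> is a convolution in \<open>k\<close>, hence is bounded by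
  \<open>\<psi> z * \<phi> z ^ k / z ^ n\<close>, where \<open>\<psi>\<close> and \<open>\<phi>\<close> generate the probabilities of staying in and of leaving a row.
  As \<open>\<phi>'(1) = m\<close>, the choice of \<open>z\<close> close to 1 on either side gives exponential deviation bounds, and
  Borel-Cantelli applies.  The first coordinate follows from the martingale \<open>x - 3 * y - n\<close>.

  In a row, a site \<open>{e1}\<close> is a wall that is crossed only to the right.  At distance \<open>j\<close> from the last
  wall the probability of reaching the next site to the right is an explicit \<open>\<alpha> j\<close>, so that the expected
  number of visits to walls is a series in products of the \<open>\<alpha> j\<close>.  Its mean is a functional of the Markov
  chain that records the distance to the last wall; the stationary equations of that chain can be solved
  and produce the two values of \<open>Theta\<close>.
\<close>

section \<open>Independent coins\<close>

text \<open>Sojourn times in the rows are never built as random variables on path space.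
  Independence enters only through integrals of functionals of the environment over disjoint sets of
  sites, and the convolution is possible because, after averaging, what happens below a row does not
  depend on the column of entry. The mean time has the form 3 + (visits to walls): every visit to a
  site that is not a wall leaves the row with probability 1/3, and the row is left exactly once, so
  there are three such visits on average. The constant \<open>gam\<close> is the larger root of t^2
  - 3 t + 1, the characteristic polynomial of 3 f(x) = f(x - 1) + f(x + 1), which governs the walk
  killed on leaving its row. A wall screens off everything to its left, so the distance to the last
  wall is a sufficient state. Its stationary equations leave one unknown, the mass at distance 0,
  for which a linear equation remains; solving it produces the quotient in the formula. The same
  series appears in its solution and in its coefficient later on, hence the square. Expectations are
  taken in \<open>ennreal\<close>; their finiteness is a separate matter, settled by the Lyapunov
  function \<open>run_bound\<close>.\<close>

definition coin_space :: "real \<Rightarrow> ('i \<Rightarrow> bool) measure" where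
  "coin_space p = PiM UNIV (\<lambda>_. measure_pmf (bernoulli_pmf p))"

text \<open>Dependence on a set of sites is a pointwise condition instead of measurability for a
  sub-sigma-algebra, so that it can be checked by unfolding; together with measurability it yields
  independence in \<open>nn_integral_coin_mult\<close>.\<close>

definition depends_on :: "'i set \<Rightarrow> (('i \<Rightarrow> 'b) \<Rightarrow> 'c) \<Rightarrow> bool" where
  "depends_on S f \<longleftrightarrow> (\<forall>w w'. (\<forall>i\<in>S. w i = w' i) \<longrightarrow> f w = f w')"

lemma depends_onI: "(\<And>w w'. (\<And>i. i \<in> S \<Longrightarrow> w i = w' i) \<Longrightarrow> f w = f w') \<Longrightarrow> depends_on S f"
  unfolding depends_on_def by blast

lemma depends_onD: "depends_on S f \<Longrightarrow> (\<And>i. i \<in> S \<Longrightarrow> w i = w' i) \<Longrightarrow> f w = f w'"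
  unfolding depends_on_def by blast

lemma depends_on_mono: "depends_on S f \<Longrightarrow> S \<subseteq> T \<Longrightarrow> depends_on T f"
  unfolding depends_on_def by blast

lemma depends_on_component: "i \<in> S \<Longrightarrow> depends_on S (\<lambda>w. g (w i))"
  unfolding depends_on_def by simp

lemma depends_on_mult:
  "depends_on S f \<Longrightarrow> depends_on S g \<Longrightarrow> depends_on S (\<lambda>w. f w * g w)"
  unfolding depends_on_def by metis

lemma prob_space_coin_space: "prob_space (coin_space p)"
  unfolding coin_space_def by (intro prob_space_PiM measure_pmf.prob_space_axioms)

lemma space_coin_space [simp]: "space (coin_space p) = UNIV"
  by (simp add: coin_space_def space_PiM)

lemma measurable_coin_component [measurable]: "(\<lambda>w. w i) \<in> coin_space p \<rightarrow>\<^sub>M count_space UNIV"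
proof -
  have "(\<lambda>w. w i) \<in> coin_space p \<rightarrow>\<^sub>M measure_pmf (bernoulli_pmf p)"
    unfolding coin_space_def by (rule measurable_component_singleton) simp
  then show ?thesis by simp
qed

lemma sets_coin_space:
  "sets (coin_space p :: ('i \<Rightarrow> bool) measure) = sets (PiM UNIV (\<lambda>_. count_space UNIV))"
  unfolding coin_space_def by (rule sets_PiM_cong) auto

lemma indep_vars_coin_space:
  "prob_space.indep_vars (coin_space p) (\<lambda>_. measure_pmf (bernoulli_pmf p)) (\<lambda>i w. w i) (UNIV :: 'i set)"
proof -
  interpret prob_space "coin_space p :: ('i \<Rightarrow> bool) measure" by (rule prob_space_coin_space)
  have "distr (coin_space p) (measure_pmf (bernoulli_pmf p)) (\<lambda>w. w i) = measure_pmf (bernoulli_pmf p)"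
    for i :: 'i
    unfolding coin_space_def by (rule distr_PiM_component) (auto intro: measure_pmf.prob_space_axioms)
  moreover have "distr (coin_space p) (PiM UNIV (\<lambda>_. measure_pmf (bernoulli_pmf p))) (\<lambda>w. w) =
      (coin_space p :: ('i \<Rightarrow> bool) measure)"
    unfolding coin_space_def by (rule distr_id)
  ultimately show ?thesis
    using measurable_coin_component
    by (subst indep_vars_iff_distr_eq_PiM) (simp_all add: coin_space_def restrict_UNIV)
qed

lemma nn_integral_coin_mult:
  fixes f g :: "('i \<Rightarrow> bool) \<Rightarrow> ennreal"
  assumes [measurable]: "f \<in> borel_measurable (coin_space p)" "g \<in> borel_measurable (coin_space p)"
    and f: "depends_on I f" and g: "depends_on J g" and IJ: "I \<inter> J = {}"
  shows "(\<integral>\<^sup>+w. f w * g w \<partial>coin_space p) = (\<integral>\<^sup>+w. f w \<partial>coin_space p) * (\<integral>\<^sup>+w. g w \<partial>coin_space p)"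
proof -
  interpret prob_space "coin_space p :: ('i \<Rightarrow> bool) measure" by (rule prob_space_coin_space)
  let ?B = "measure_pmf (bernoulli_pmf p)"
  \<comment> \<open>A configuration on \<open>K\<close> is extended by \<open>False\<close>. As
    \<open>f\<close> looks only at \<open>I\<close>, it factors through the restriction to
    \<open>I\<close>, and restrictions to disjoint sets are independent.\<close>
  let ?ext = "\<lambda>K x i. i \<in> K \<and> x i"
  have ext: "?ext K \<in> PiM K (\<lambda>_. ?B) \<rightarrow>\<^sub>M coin_space p" for K :: "'i set"
  proof -
    have "(\<lambda>x. i \<in> K \<and> x i) \<in> PiM K (\<lambda>_. ?B) \<rightarrow>\<^sub>M ?B" for i
      using measurable_component_singleton[of i K "\<lambda>_. ?B"] by (cases "i \<in> K") simp_all
    then show ?thesis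
      unfolding coin_space_def by (intro measurable_PiM_single') auto
  qed
  have eq_f: "f \<circ> ?ext I \<circ> (\<lambda>w. restrict w I) = f"
    by (rule HOL.ext, unfold comp_apply, rule depends_onD[OF f], simp)
  have eq_g: "g \<circ> ?ext J \<circ> (\<lambda>w. restrict w J) = g"
    by (rule HOL.ext, unfold comp_apply, rule depends_onD[OF g], simp)
  have "indep_var (PiM I (\<lambda>_. ?B)) (\<lambda>w. restrict w I) (PiM J (\<lambda>_. ?B)) (\<lambda>w. restrict w J)"
    using indep_var_restrict[OF indep_vars_coin_space IJ] by simp
  from indep_var_compose[OF this measurable_comp[OF ext assms(1)] measurable_comp[OF ext assms(2)]]
  have "indep_var borel f borel g" by (simp only: eq_f eq_g)
  moreover have "case_bool borel borel = (\<lambda>_. borel :: ennreal measure)"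
    by (rule HOL.ext) (simp split: bool.split)
  ultimately have "indep_vars (\<lambda>_. borel) (case_bool f g) UNIV"
    unfolding indep_var_def by (simp only:)
  then have "(\<integral>\<^sup>+w. (\<Prod>i\<in>UNIV. case_bool f g i w) \<partial>coin_space p) =
      (\<Prod>i\<in>UNIV. \<integral>\<^sup>+w. case_bool f g i w \<partial>coin_space p)"
    by (rule indep_vars_nn_integral[OF finite[of "UNIV :: bool set"]]) (rule zero_le)
  also have "(\<lambda>w. \<Prod>i\<in>UNIV. case_bool f g i w) = (\<lambda>w. f w * g w)"
    by (rule HOL.ext) (simp add: UNIV_bool mult.commute)
  finally show ?thesis by (simp add: UNIV_bool mult.commute)
qed

lemma nn_integral_coin_component:
  assumes "0 \<le> p" "p \<le> 1"
  shows "(\<integral>\<^sup>+w. h (w i) \<partial>coin_space p) = ennreal p * h True + ennreal (1 - p) * h False"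
proof -
  have "integral\<^sup>N (distr (coin_space p) (measure_pmf (bernoulli_pmf p)) (\<lambda>w. w i)) h =
      (\<integral>\<^sup>+w. h (w i) \<partial>coin_space p)"
    using measurable_coin_component[of i p] by (intro nn_integral_distr) simp_all
  moreover have "distr (coin_space p) (measure_pmf (bernoulli_pmf p)) (\<lambda>w. w i) = measure_pmf (bernoulli_pmf p)"
    unfolding coin_space_def by (rule distr_PiM_component) (auto intro: measure_pmf.prob_space_axioms)
  ultimately have "(\<integral>\<^sup>+w. h (w i) \<partial>coin_space p) = integral\<^sup>N (measure_pmf (bernoulli_pmf p)) h"
    by simp
  also have "\<dots> = (\<Sum>b\<in>UNIV. h b * ennreal (pmf (bernoulli_pmf p) b))"
    by (intro nn_integral_measure_pmf_support) auto
  also have "\<dots> = h False * ennreal (1 - p) + h True * ennreal p"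
    using assms by (simp add: UNIV_bool)
  also have "\<dots> = ennreal p * h True + ennreal (1 - p) * h False"
    by (simp add: ac_simps)
  finally show ?thesis .
qed

text \<open>Reading i.i.d. coins along an injection gives i.i.d. coins again. This serves both for
  translations of the plane and for the embedding of a row into the plane.\<close>

lemma nn_integral_coin_reindex:
  fixes t :: "'j \<Rightarrow> 'i"
  assumes "inj t" and [measurable]: "f \<in> borel_measurable (coin_space p)"
  shows "(\<integral>\<^sup>+w. f (\<lambda>j. w (t j)) \<partial>coin_space p) = (\<integral>\<^sup>+w. f w \<partial>coin_space p)"
proof -
  have "distr (coin_space p) (coin_space p) (\<lambda>w j. w (t j)) = coin_space p"
    using distr_PiM_reindex[of UNIV "\<lambda>_. measure_pmf (bernoulli_pmf p)" t UNIV] assms(1)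
    by (simp add: coin_space_def measure_pmf.prob_space_axioms restrict_UNIV)
  moreover have "(\<lambda>w j. w (t j)) \<in> coin_space p \<rightarrow>\<^sub>M coin_space p"
    unfolding coin_space_def
    using measurable_coin_component by (intro measurable_PiM_single') (simp_all add: coin_space_def)
  ultimately show ?thesis
    using nn_integral_distr[of "\<lambda>w j. w (t j)" "coin_space p" "coin_space p" f] assms(2) by (simp only:)
qed

section \<open>The walk seen row by row\<close>

text \<open>Backward operator of the horizontal motion killed at a step down: the expectation of
  \<open>f\<close> one step later on the event of staying in the row. The value \<open>True\<close>
  marks a site with three possible steps, \<open>False\<close> a wall.\<close>

definition row_op :: "(int \<Rightarrow> bool) \<Rightarrow> (int \<Rightarrow> ennreal) \<Rightarrow> int \<Rightarrow> ennreal" where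
  "row_op r f x = (if r x then (f (x - 1) + f (x + 1)) / 3 else f (x + 1))"

definition row_exit :: "(int \<Rightarrow> bool) \<Rightarrow> int \<Rightarrow> ennreal" where
  "row_exit r x = (if r x then 1 / 3 else 0)"

definition walk_op :: "(site \<Rightarrow> bool) \<Rightarrow> (site \<Rightarrow> ennreal) \<Rightarrow> site \<Rightarrow> ennreal" where
  "walk_op w f s = (if w s then (f (s + e1) + f (s - e1) + f (s - e2)) / 3 else f (s + e1))"

abbreviation row_of :: "(site \<Rightarrow> bool) \<Rightarrow> int \<Rightarrow> int \<Rightarrow> bool" where
  "row_of w y \<equiv> \<lambda>x. w (x, y)"

text \<open>Powers of the backward operator applied to an indicator stand in for the law of the
  path: this is the quenched probability that the walk started at \<open>(x, y)\<close> has
  descended by exactly \<open>k\<close> rows at time \<open>n\<close>.\<close>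

definition depth_prob :: "(site \<Rightarrow> bool) \<Rightarrow> nat \<Rightarrow> nat \<Rightarrow> int \<Rightarrow> int \<Rightarrow> ennreal" where
  "depth_prob w k n x y = (walk_op w ^^ n) (\<lambda>s. indicator {y - int k} (snd s)) (x, y)"

lemma row_op_measurable [measurable]:
  assumes [measurable]: "\<And>x. (\<lambda>w. f w x) \<in> borel_measurable N" "\<And>x. Measurable.pred N (\<lambda>w. r w x)"
  shows "(\<lambda>w. row_op (r w) (f w) x) \<in> borel_measurable N"
  unfolding row_op_def by measurable

lemma row_op_funpow_measurable [measurable]:
  assumes [measurable]: "\<And>x. (\<lambda>w. f w x) \<in> borel_measurable N" "\<And>x. Measurable.pred N (\<lambda>w. r w x)"
  shows "(\<lambda>w. (row_op (r w) ^^ n) (f w) x) \<in> borel_measurable N"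
  by (induction n arbitrary: x) simp_all

lemma row_exit_measurable [measurable]:
  assumes [measurable]: "\<And>x. Measurable.pred N (\<lambda>w. r w x)"
  shows "(\<lambda>w. row_exit (r w) x) \<in> borel_measurable N"
  unfolding row_exit_def by measurable

lemma walk_op_measurable [measurable]:
  assumes [measurable]: "\<And>x. (\<lambda>w. f w x) \<in> borel_measurable N" "\<And>x. Measurable.pred N (\<lambda>w. r w x)"
  shows "(\<lambda>w. walk_op (r w) (f w) x) \<in> borel_measurable N"
  unfolding walk_op_def by measurable

lemma walk_op_funpow_measurable [measurable]:
  assumes [measurable]: "\<And>x. (\<lambda>w. f w x) \<in> borel_measurable N" "\<And>x. Measurable.pred N (\<lambda>w. r w x)"
  shows "(\<lambda>w. (walk_op (r w) ^^ n) (f w) x) \<in> borel_measurable N"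
  by (induction n arbitrary: x) simp_all

lemma depth_prob_measurable [measurable]:
  assumes [measurable]: "\<And>x. Measurable.pred N (\<lambda>w. r w x)"
  shows "(\<lambda>w. depth_prob (r w) k n x y) \<in> borel_measurable N"
  unfolding depth_prob_def by measurable

lemma row_op_mono: "(\<And>x. f x \<le> g x) \<Longrightarrow> row_op r f x \<le> row_op r g x"
  unfolding row_op_def by (auto intro!: divide_right_mono_ennreal add_mono)

lemma row_op_funpow_mono: "(\<And>x. f x \<le> g x) \<Longrightarrow> (row_op r ^^ n) f x \<le> (row_op r ^^ n) g x"
  by (induction n arbitrary: x) (auto intro!: row_op_mono)

lemma row_op_add: "row_op r (\<lambda>x. f x + g x) x = row_op r f x + row_op r g x"
  by (auto simp: row_op_def add_divide_distrib_ennreal ac_simps)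

lemma row_op_funpow_add:
  "(row_op r ^^ n) (\<lambda>x. f x + g x) x = (row_op r ^^ n) f x + (row_op r ^^ n) g x"
proof (induction n arbitrary: x)
  case (Suc n)
  then have "(row_op r ^^ n) (\<lambda>x. f x + g x) = (\<lambda>x. (row_op r ^^ n) f x + (row_op r ^^ n) g x)" by blast
  then show ?case by (simp add: row_op_add)
qed simp

lemma row_op_cmult: "row_op r (\<lambda>x. c * f x) x = c * row_op r f x"
  by (auto simp: row_op_def distrib_left ennreal_times_divide)

lemma row_op_funpow_cmult: "(row_op r ^^ n) (\<lambda>x. c * f x) x = c * (row_op r ^^ n) f x"
proof (induction n arbitrary: x)
  case (Suc n)
  then have "(row_op r ^^ n) (\<lambda>x. c * f x) = (\<lambda>x. c * (row_op r ^^ n) f x)" by blast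
  then show ?case by (simp add: row_op_cmult)
qed simp

lemma row_op_one_plus_exit: "row_op r (\<lambda>_. 1) x + row_exit r x = 1"
proof -
  have "(1 + 1) / 3 + 1 / 3 = (1 :: ennreal)"
    by (simp add: add_divide_distrib_ennreal[symmetric] ennreal_divide_self)
  then show ?thesis by (simp add: row_op_def row_exit_def)
qed

lemma row_op_stay_exit:
  "(row_op r ^^ n) (\<lambda>_. 1) x = (row_op r ^^ Suc n) (\<lambda>_. 1) x + (row_op r ^^ n) (row_exit r) x"
proof -
  have "(row_op r ^^ n) (\<lambda>_. 1) x = (row_op r ^^ n) (\<lambda>x. row_op r (\<lambda>_. 1) x + row_exit r x) x"
    by (simp add: row_op_one_plus_exit)
  then show ?thesis
    by (simp add: row_op_funpow_add funpow_Suc_right del: funpow.simps)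
qed

section \<open>One step of the walk: staying in the row or leaving it\<close>

lemma walk_op_row:
  "walk_op w f (x, y) = row_op (row_of w y) (\<lambda>x. f (x, y)) x + row_exit (row_of w y) x * f (x, y - 1)"
  by (simp add: walk_op_def row_op_def row_exit_def e1_def e2_def add_divide_distrib_ennreal
      ennreal_times_divide[symmetric] ac_simps ennreal_divide_times)

text \<open>No step leads upwards, so the rows above the starting point are never consulted. This
  locality is what makes a row independent of the future below it.\<close>

lemma walk_op_cong_below:
  assumes "\<And>x' y'. y' \<le> y \<Longrightarrow> f (x', y') = g (x', y')" "\<And>x' y'. y' \<le> y \<Longrightarrow> w (x', y') = w' (x', y')"
  shows "(walk_op w ^^ n) f (x, y) = (walk_op w' ^^ n) g (x, y)"
  using assms
proof (induction n arbitrary: x y)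
  case (Suc n)
  then show ?case
    by (simp add: walk_op_def e1_def e2_def)
qed simp

lemma walk_op_funpow_zero [simp]: "(walk_op w ^^ n) (\<lambda>_. 0) s = 0"
  by (induction n arbitrary: s) (auto simp: walk_op_def)

lemma depth_prob_Suc:
  "depth_prob w 0 (Suc n) x y = row_op (row_of w y) (\<lambda>x. depth_prob w 0 n x y) x"
  "depth_prob w (Suc k) (Suc n) x y =
     row_op (row_of w y) (\<lambda>x. depth_prob w (Suc k) n x y) x + row_exit (row_of w y) x * depth_prob w k n x (y - 1)"
proof -
  \<comment> \<open>After a step down, row \<open>y\<close> is out of reach, so the exit term
    vanishes at depth 0.\<close>
  have "(walk_op w ^^ n) (\<lambda>s. indicator {y} (snd s)) (x, y - 1) = (walk_op w ^^ n) (\<lambda>_. 0) (x, y - 1)"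
    by (rule walk_op_cong_below) auto
  then show "depth_prob w 0 (Suc n) x y = row_op (row_of w y) (\<lambda>x. depth_prob w 0 n x y) x"
    by (simp add: depth_prob_def walk_op_row)
  have "y - 1 - int k = y - int (Suc k)" by simp
  then show "depth_prob w (Suc k) (Suc n) x y = row_op (row_of w y) (\<lambda>x. depth_prob w (Suc k) n x y) x +
      row_exit (row_of w y) x * depth_prob w k n x (y - 1)"
    unfolding depth_prob_def by (simp only: funpow.simps comp_apply walk_op_row)
qed

lemma depth_prob_0 [simp]: "depth_prob w 0 0 x y = 1" "depth_prob w (Suc k) 0 x y = 0"
  by (simp_all add: depth_prob_def)

lemma depth_prob_stay: "depth_prob w 0 n x y = (row_op (row_of w y) ^^ n) (\<lambda>_. 1) x"
proof (induction n arbitrary: x)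
  case (Suc n)
  then have "(\<lambda>x. depth_prob w 0 n x y) = (row_op (row_of w y) ^^ n) (\<lambda>_. 1)" by blast
  then show ?case by (simp add: depth_prob_Suc)
qed simp

lemma depends_on_depth_prob: "depends_on {s. snd s \<le> y} (\<lambda>w. depth_prob w k n x y)"
  unfolding depth_prob_def by (intro depends_onI walk_op_cong_below) auto

lemma walk_op_funpow_shift:
  "(walk_op (\<lambda>s. w (s + t)) ^^ n) (\<lambda>s. f (s + t)) s = (walk_op w ^^ n) f (s + t)"
  by (induction n arbitrary: s) (simp_all add: walk_op_def algebra_simps)

definition mean_depth_prob :: "real \<Rightarrow> nat \<Rightarrow> nat \<Rightarrow> ennreal" where
  "mean_depth_prob p k n = (\<integral>\<^sup>+w. depth_prob w k n 0 0 \<partial>coin_space p)"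

text \<open>The index counts the steps made inside the row before the exit; the exit itself takes
  place at step n + 1. Hence the index \<open>n - 1 - i\<close> in the convolutions and the power
  \<open>Suc i\<close> in the generating function.\<close>

definition mean_exit_prob :: "real \<Rightarrow> nat \<Rightarrow> ennreal" where
  "mean_exit_prob p n = (\<integral>\<^sup>+w. (row_op (row_of w 0) ^^ n) (row_exit (row_of w 0)) 0 \<partial>coin_space p)"

lemma coin_pred [measurable]: "Measurable.pred (coin_space p) (\<lambda>w. w i)"
  by simp

text \<open>Translation invariance of the environment. It removes the column in which a new row is
  entered, although that column is correlated with the time spent in the row above.\<close>

lemma nn_integral_depth_prob:
  "(\<integral>\<^sup>+w. depth_prob w k n x y \<partial>coin_space p) = mean_depth_prob p k n"
proof -
  have "(\<lambda>s :: site. indicator {y - int k} (snd (s + (x, y))) :: ennreal) = (\<lambda>s. indicator {0 - int k} (snd s))"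
    by (intro HOL.ext) (simp add: indicator_def add.commute)
  then have "depth_prob w k n x y = depth_prob (\<lambda>s. w (s + (x, y))) k n 0 0" for w
    using walk_op_funpow_shift[where w = w and t = "(x, y)" and n = n and s = "(0, 0)"
        and f = "\<lambda>s. indicator {y - int k} (snd s)"]
    by (simp only: depth_prob_def) simp
  then have "(\<integral>\<^sup>+w. depth_prob w k n x y \<partial>coin_space p) =
      (\<integral>\<^sup>+w. depth_prob (\<lambda>s. w (s + (x, y))) k n 0 0 \<partial>coin_space p)" by simp
  also have "\<dots> = mean_depth_prob p k n"
    unfolding mean_depth_prob_def
    by (rule nn_integral_coin_reindex[of "\<lambda>s. s + (x, y)" "\<lambda>w. depth_prob w k n 0 0"]) (auto simp: inj_def)
  finally show ?thesis .
qed

text \<open>Each summand is a function of the coin at \<open>x\<close> times a value of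
  \<open>f\<close>, so that the first factor can be absorbed into a weight.\<close>

lemma row_op_indicator:
  "row_op r f x = row_exit r x * f (x - 1) + row_exit r x * f (x + 1) + (if r x then 0 else 1) * f (x + 1)"
  by (simp add: row_op_def row_exit_def add_divide_distrib_ennreal ennreal_divide_times)

text \<open>
  The weight \<open>h\<close> makes the induction go through: each step inside the row multiplies it by a transition
  probability of that row, while the rows below stay independent of it.
\<close>
lemma nn_integral_depth_prob_Suc:
  assumes "depends_on {s. snd s = y} h" "h \<in> borel_measurable (coin_space p)"
  shows "(\<integral>\<^sup>+w. h w * depth_prob w (Suc k) n x y \<partial>coin_space p) =
    (\<Sum>i<n. (\<integral>\<^sup>+w. h w * (row_op (row_of w y) ^^ i) (row_exit (row_of w y)) x \<partial>coin_space p) *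
       mean_depth_prob p k (n - 1 - i))"
  using assms
proof (induction n arbitrary: x h)
  case 0
  then show ?case by simp
next
  case (Suc n)
  note [measurable] = Suc.prems(2)
  let ?I = "\<lambda>f. \<integral>\<^sup>+w. f w \<partial>coin_space p"
  define e where "e = (\<lambda>w. h w * row_exit (row_of w y) x)"
  define s where "s = (\<lambda>w. h w * (if row_of w y x then 0 else 1))"
  have e: "depends_on {s. snd s = y} e" and s: "depends_on {s. snd s = y} s"
    unfolding e_def s_def row_exit_def
    by (intro depends_on_mult Suc.prems depends_on_component; simp)+
  have [measurable]: "e \<in> borel_measurable (coin_space p)" "s \<in> borel_measurable (coin_space p)"
    unfolding e_def s_def by measurable
  have split: "h w * row_op (row_of w y) f x = e w * f (x - 1) + e w * f (x + 1) + s w * f (x + 1)" for w f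
    by (simp add: row_op_indicator e_def s_def distrib_left mult.assoc)
  let ?r = "\<lambda>w. row_op (row_of w y)" and ?c = "\<lambda>w. row_exit (row_of w y)"
  let ?m = "mean_depth_prob p k"
  have split_int: "?I (\<lambda>w. h w * row_op (row_of w y) (f w) x) =
      ?I (\<lambda>w. e w * f w (x - 1)) + ?I (\<lambda>w. e w * f w (x + 1)) + ?I (\<lambda>w. s w * f w (x + 1))"
    if [measurable]: "\<And>x. (\<lambda>w. f w x) \<in> borel_measurable (coin_space p)" for f
    by (simp add: split nn_integral_add)
  \<comment> \<open>The weight looks only at row \<open>y\<close>, the rest only at lower rows, so
    the integral factors; averaging then forgets the column \<open>x\<close>.\<close>
  have "?I (\<lambda>w. e w * depth_prob w k n x (y - 1)) = ?I e * ?m n"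
    by (subst nn_integral_coin_mult[OF _ _ e depends_on_depth_prob]) (auto simp: nn_integral_depth_prob)
  then have "?I (\<lambda>w. h w * depth_prob w (Suc k) (Suc n) x y) =
      ?I (\<lambda>w. h w * ?r w (\<lambda>x. depth_prob w (Suc k) n x y) x) + ?I e * ?m n"
    by (simp add: depth_prob_Suc distrib_left nn_integral_add e_def mult.assoc)
  also have "?I (\<lambda>w. h w * ?r w (\<lambda>x. depth_prob w (Suc k) n x y) x) =
      (\<Sum>i<n. (?I (\<lambda>w. e w * (?r w ^^ i) (?c w) (x - 1)) + ?I (\<lambda>w. e w * (?r w ^^ i) (?c w) (x + 1)) +
        ?I (\<lambda>w. s w * (?r w ^^ i) (?c w) (x + 1))) * ?m (n - 1 - i))"
    by (simp add: split_int Suc.IH e s sum.distrib distrib_right)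
  also have "\<dots> = (\<Sum>i<n. ?I (\<lambda>w. h w * (?r w ^^ Suc i) (?c w) x) * ?m (n - 1 - i))"
    by (simp add: split_int)
  also have "\<dots> + ?I e * ?m n = (\<Sum>i<Suc n. ?I (\<lambda>w. h w * (?r w ^^ i) (?c w) x) * ?m (Suc n - 1 - i))"
    by (simp add: sum.lessThan_Suc_shift e_def add.commute del: sum.lessThan_Suc)
  finally show ?case .
qed

lemma mean_depth_prob_Suc:
  "mean_depth_prob p (Suc k) n = (\<Sum>i<n. mean_exit_prob p i * mean_depth_prob p k (n - 1 - i))"
  using nn_integral_depth_prob_Suc[of 0 "\<lambda>_. 1" p k n 0]
  by (simp add: depends_on_def mean_depth_prob_def mean_exit_prob_def)

lemma mean_depth_prob_stay_exit:
  "mean_depth_prob p 0 n = mean_depth_prob p 0 (Suc n) + mean_exit_prob p n"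
  unfolding mean_depth_prob_def mean_exit_prob_def depth_prob_stay
  by (subst nn_integral_add[symmetric]) (simp_all add: row_op_stay_exit[symmetric] del: funpow.simps)

section \<open>Exponential tails for the time spent in a row\<close>

definition run_weight :: "real \<Rightarrow> bool \<Rightarrow> ennreal" where
  "run_weight z b = ennreal (if b then 3 / 4 else z)"

text \<open>A Lyapunov function for the row. The weight 3/4 dominates \<open>advance_prob\<close>
  away from walls, and the weight \<open>z\<close> at a wall pays for the factor \<open>z\<close>
  charged per step.\<close>

definition run_bound :: "real \<Rightarrow> (int \<Rightarrow> bool) \<Rightarrow> int \<Rightarrow> ennreal" where
  "run_bound z r x = (\<Sum>k. \<Prod>i<k. run_weight z (r (x + int i)))"

lemma suminf_prod_shift:
  fixes f g :: "int \<Rightarrow> ennreal"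
  shows "(\<Sum>k. (\<Prod>i<k. f (x + int i)) * g (x + int k)) =
    g x + f x * (\<Sum>k. (\<Prod>i<k. f (x + 1 + int i)) * g (x + 1 + int k))"
proof -
  let ?F = "\<lambda>k. (\<Prod>i<k. f (x + int i)) * g (x + int k)"
  have "?F (Suc k) = f x * ((\<Prod>i<k. f (x + 1 + int i)) * g (x + 1 + int k))" for k
    by (simp add: prod.lessThan_Suc_shift mult.assoc add.commute add.left_commute del: prod.lessThan_Suc)
  then have "(\<Sum>k. ?F (Suc k)) = f x * (\<Sum>k. (\<Prod>i<k. f (x + 1 + int i)) * g (x + 1 + int k))"
    by simp
  moreover have "(\<Sum>k. ?F k) = ?F 0 + (\<Sum>k. ?F (Suc k))"
    using suminf_offset[of ?F 1] by simp
  ultimately show ?thesis by simp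
qed

lemma run_bound_rec: "run_bound z r x = 1 + run_weight z (r x) * run_bound z r (x + 1)"
  unfolding run_bound_def
  using suminf_prod_shift[of "\<lambda>x. run_weight z (r x)" x "\<lambda>_. 1"] by simp

lemma run_bound_ge_1: "1 \<le> run_bound z r x"
  by (subst run_bound_rec) simp

text \<open>At a wall this is read off the recursion. Elsewhere all terms are bounded through the
  value \<open>u\<close> at x + 1, and an affine inequality in \<open>u\<close> remains, for which z
  \<le> 11/10 leaves enough room.\<close>

lemma run_bound_supersolution:
  assumes z: "1 \<le> z" "z \<le> 11 / 10"
  shows "ennreal z * row_op r (run_bound z r) x \<le> run_bound z r x"
proof (cases "r x")
  case False
  then show ?thesis
    using run_bound_rec[of z r x] by (simp add: row_op_def run_weight_def)
next
  case True
  let ?H = "run_bound z r"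
  let ?h = "?H (x + 1)"
  have Hx: "?H x = 1 + ennreal (3 / 4) * ?h"
    using True by (subst run_bound_rec) (simp add: run_weight_def)
  \<comment> \<open>The left neighbour may or may not be a wall; as 3/4 \<le> 1 \<le> z, the wall is
    the worse case.\<close>
  have "run_weight z (r (x - 1)) \<le> ennreal z"
    using z by (auto simp: run_weight_def intro!: ennreal_leI)
  then have "?H (x - 1) \<le> 1 + ennreal z * ?H x"
    by (subst run_bound_rec) (auto intro!: add_mono mult_right_mono)
  then have "ennreal z * row_op r ?H x \<le> ennreal z * ((1 + ennreal z * ?H x + ?h) / 3)"
    using True by (auto simp: row_op_def intro!: mult_left_mono divide_right_mono_ennreal add_mono)
  also have "\<dots> \<le> ?H x"
  proof (cases "?h = \<top>")
    case True
    then show ?thesis by (simp add: Hx ennreal_mult_top)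
  next
    case False
    then obtain u where u: "?h = ennreal u" "0 \<le> u" by (cases ?h) auto
    have "z * ((1 + z * (1 + 3 / 4 * u) + u) / 3) \<le> 1 + 3 / 4 * u"
    proof -
      have "z * z \<le> (11 / 10) * (11 / 10)" using z by (intro mult_mono) auto
      then have "u * (z * z) \<le> u * (121 / 100)" using u by (intro mult_left_mono) auto
      moreover have "u * z \<le> u * (11 / 10)" using z u by (intro mult_left_mono) auto
      ultimately show ?thesis
        using z \<open>z * z \<le> _\<close> u by (simp add: field_simps)
    qed
    moreover have "ennreal z * ((1 + ennreal z * (1 + ennreal (3 / 4) * ennreal u) + ennreal u) / 3) =
        ennreal (z * ((1 + z * (1 + 3 / 4 * u) + u) / 3))"
    proof -
      have "ennreal z * ((ennreal 1 + ennreal z * (ennreal 1 + ennreal (3 / 4) * ennreal u) + ennreal u) / ennreal 3) =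
          ennreal (z * ((1 + z * (1 + 3 / 4 * u) + u) / 3))"
        using z u by (simp add: ennreal_mult[symmetric] ennreal_plus[symmetric] divide_ennreal
            del: ennreal_plus ennreal_1 ennreal_numeral)
      then show ?thesis by (simp only: ennreal_1 ennreal_numeral)
    qed
    moreover have "1 + ennreal (3 / 4) * ennreal u = ennreal (1 + 3 / 4 * u)"
      using u by (simp add: ennreal_mult[symmetric])
    ultimately show ?thesis
      unfolding Hx u by (simp only: ennreal_leI)
  qed
  finally show ?thesis .
qed

text \<open>Iteration of the supersolution property: \<open>z ^ n\<close> times
  \<open>run_bound\<close> along the killed walk is a supermartingale. Since
  \<open>run_bound\<close> is at least 1, the time spent in the row has an exponential tail.\<close>

lemma run_bound_decay:
  assumes z: "1 \<le> z" "z \<le> 11 / 10"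
  shows "ennreal z ^ n * (row_op r ^^ n) (run_bound z r) x \<le> run_bound z r x"
proof (induction n)
  case (Suc n)
  have "ennreal z ^ Suc n * (row_op r ^^ Suc n) (run_bound z r) x =
      ennreal z ^ n * (row_op r ^^ n) (\<lambda>x. ennreal z * row_op r (run_bound z r) x) x"
    by (simp add: funpow_Suc_right row_op_funpow_cmult mult.assoc mult.left_commute del: funpow.simps)
  also have "\<dots> \<le> ennreal z ^ n * (row_op r ^^ n) (run_bound z r) x"
    by (intro mult_left_mono row_op_funpow_mono run_bound_supersolution z) auto
  finally show ?case using Suc by order
qed simp

lemma nn_integral_run_weight_prod:
  assumes "0 \<le> p" "p \<le> 1" "0 \<le> z"
  shows "(\<integral>\<^sup>+r. (\<Prod>i<k. run_weight z (r (x + int i))) \<partial>coin_space p) = ennreal (p * 3 / 4 + (1 - p) * z) ^ k"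
proof (induction k)
  case 0
  interpret prob_space "coin_space p :: (int \<Rightarrow> bool) measure" by (rule prob_space_coin_space)
  show ?case by (simp add: emeasure_space_1[simplified])
next
  case (Suc k)
  have w: "(\<lambda>r. run_weight z (r y)) \<in> borel_measurable (coin_space p)" for y :: int
    unfolding run_weight_def by measurable
  have "(\<integral>\<^sup>+r. (\<Prod>i<Suc k. run_weight z (r (x + int i))) \<partial>coin_space p) =
      (\<integral>\<^sup>+r. (\<Prod>i<k. run_weight z (r (x + int i))) \<partial>coin_space p) *
      (\<integral>\<^sup>+r. run_weight z (r (x + int k)) \<partial>coin_space p)"
    unfolding prod.lessThan_Suc
    by (rule nn_integral_coin_mult[where I = "{y. y < x + int k}" and J = "{x + int k}"])
       (auto intro!: borel_measurable_prod_ennreal w prod.cong depends_onI)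
  also have "(\<integral>\<^sup>+r. run_weight z (r (x + int k)) \<partial>coin_space p) = ennreal (p * 3 / 4 + (1 - p) * z)"
    using assms by (subst nn_integral_coin_component)
      (simp_all add: run_weight_def ennreal_mult[symmetric] ennreal_plus[symmetric] del: ennreal_plus)
  finally show ?case by (simp add: Suc.IH mult.commute)
qed

lemma run_bound_measurable [measurable]: "(\<lambda>r. run_bound z r x) \<in> borel_measurable (coin_space p)"
  unfolding run_bound_def run_weight_def by measurable

lemma nn_integral_run_bound:
  assumes p: "0 < p" "p < 1"
  shows "(\<integral>\<^sup>+r. run_bound (1 + p / 10) r x \<partial>coin_space p) < \<infinity>"
proof -
  \<comment> \<open>The mean weight of a site. The choice z = 1 + p/10 keeps it below 1, because the
    gain (1 - p) p/10 at walls is less than the loss p/4 elsewhere, and it also respects z \<le>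
    11/10.\<close>
  let ?q = "p * 3 / 4 + (1 - p) * (1 + p / 10)"
  have q: "0 \<le> ?q" "?q < 1"
  proof -
    have "0 < p * 3 + p * (p * 2)" using p by (intro add_pos_pos mult_pos_pos) auto
    then show "?q < 1" by (simp add: field_simps)
    show "0 \<le> ?q" using p by (intro add_nonneg_nonneg mult_nonneg_nonneg) auto
  qed
  have m: "(\<lambda>r. \<Prod>i<k. run_weight (1 + p / 10) (r (x + int i))) \<in> borel_measurable (coin_space p)" for k
    unfolding run_weight_def by measurable
  have w: "(\<integral>\<^sup>+r. (\<Prod>i<k. run_weight (1 + p / 10) (r (x + int i))) \<partial>coin_space p) = ennreal (?q ^ k)" for k
  proof -
    have "ennreal (?q ^ k) = ennreal ?q ^ k" by (rule ennreal_power[symmetric, OF q(1)])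
    then show ?thesis using p by (simp only: nn_integral_run_weight_prod)
  qed
  have "(\<integral>\<^sup>+r. run_bound (1 + p / 10) r x \<partial>coin_space p) =
      (\<Sum>k. \<integral>\<^sup>+r. (\<Prod>i<k. run_weight (1 + p / 10) (r (x + int i))) \<partial>coin_space p)"
    unfolding run_bound_def using m by (rule nn_integral_suminf)
  also have "\<dots> = (\<Sum>k. ennreal (?q ^ k))"
    by (simp only: w)
  also have "\<dots> = ennreal (\<Sum>k. ?q ^ k)"
    using q by (intro suminf_ennreal2 summable_geometric) auto
  finally show ?thesis by simp
qed

section \<open>Annealed probability of still being in the starting row\<close>

definition stay_prob :: "real \<Rightarrow> nat \<Rightarrow> real" where
  "stay_prob p n = enn2real (mean_depth_prob p 0 n)"

lemma mean_depth_prob_row: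
  "mean_depth_prob p 0 n = (\<integral>\<^sup>+r. (row_op r ^^ n) (\<lambda>_. 1) 0 \<partial>coin_space p)"
  unfolding mean_depth_prob_def depth_prob_stay
  by (rule nn_integral_coin_reindex[of "\<lambda>x. (x, 0)" "\<lambda>r. (row_op r ^^ n) (\<lambda>_. 1) 0"]) (auto simp: inj_def)

lemma mean_depth_prob_le_1: "mean_depth_prob p 0 n \<le> 1"
proof -
  interpret prob_space "coin_space p :: (site \<Rightarrow> bool) measure" by (rule prob_space_coin_space)
  have "mean_depth_prob p 0 0 = 1"
    by (simp add: mean_depth_prob_def emeasure_space_1[simplified])
  moreover have "mean_depth_prob p 0 (Suc n) \<le> mean_depth_prob p 0 n" for n
    by (subst (2) mean_depth_prob_stay_exit) simp
  ultimately show ?thesis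
    by (induction n) (auto intro: order_trans)
qed

lemma ennreal_stay_prob: "ennreal (stay_prob p n) = mean_depth_prob p 0 n"
  unfolding stay_prob_def using mean_depth_prob_le_1[of p n]
  by (intro ennreal_enn2real) (auto simp: less_top[symmetric] top_unique)

lemma stay_prob_nonneg: "0 \<le> stay_prob p n"
  by (simp add: stay_prob_def)

lemma stay_prob_0: "stay_prob p 0 = 1"
proof -
  interpret prob_space "coin_space p :: (site \<Rightarrow> bool) measure" by (rule prob_space_coin_space)
  show ?thesis by (simp add: stay_prob_def mean_depth_prob_def emeasure_space_1[simplified])
qed

lemma stay_prob_decay:
  assumes p: "0 < p" "p < 1"
  obtains C where "0 \<le> C" "\<And>n. stay_prob p n * (1 + p / 10) ^ n \<le> C"
proof
  let ?z = "1 + p / 10"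
  let ?C = "\<integral>\<^sup>+r. run_bound ?z r 0 \<partial>coin_space p"
  show "0 \<le> enn2real ?C" by simp
  fix n
  have "mean_depth_prob p 0 n * ennreal ?z ^ n = (\<integral>\<^sup>+r. ennreal ?z ^ n * (row_op r ^^ n) (\<lambda>_. 1) 0 \<partial>coin_space p)"
    by (simp add: mean_depth_prob_row nn_integral_multc mult.commute)
  also have "\<dots> \<le> ?C"
  proof (rule nn_integral_mono)
    fix r :: "int \<Rightarrow> bool"
    have "ennreal ?z ^ n * (row_op r ^^ n) (\<lambda>_. 1) 0 \<le> ennreal ?z ^ n * (row_op r ^^ n) (run_bound ?z r) 0"
      by (intro mult_left_mono row_op_funpow_mono run_bound_ge_1) auto
    also have "\<dots> \<le> run_bound ?z r 0"
      using p by (intro run_bound_decay) auto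
    finally show "ennreal ?z ^ n * (row_op r ^^ n) (\<lambda>_. 1) 0 \<le> run_bound ?z r 0" .
  qed
  finally have "ennreal (stay_prob p n * ?z ^ n) \<le> ?C"
    using p by (simp add: ennreal_mult stay_prob_nonneg ennreal_stay_prob ennreal_power[symmetric] del: ennreal_plus)
  also have "?C = ennreal (enn2real ?C)"
    using nn_integral_run_bound[OF p, of 0] by (simp add: ennreal_enn2real)
  finally show "stay_prob p n * ?z ^ n \<le> enn2real ?C"
    by (subst (asm) ennreal_le_iff) auto
qed

section \<open>Expected time spent in a fixed row\<close>

lemma gam_gt_1: "1 < gam"
  by (simp add: gam_def add_pos_nonneg)

lemma gam_square: "gam * gam = 3 * gam - 1"
  by (simp add: gam_def field_simps)

text \<open>Solution of \<alpha>(j + 1) = 1 / (3 - \<alpha>(j)) with \<alpha>(0) = 1, where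
  \<alpha>(j) is the probability of ever reaching the next site to the right: from distance j + 1
  the walk moves right at once, or moves left and must then advance twice.\<close>

definition advance_prob :: "nat \<Rightarrow> real" where
  "advance_prob j = (gam ^ (2 * j) + gam) / (gam ^ (2 * j + 1) + 1)"

text \<open>The product of \<open>advance_prob i\<close> over i \<le> j: the probability of getting
  from a wall to distance j + 1 if no wall lies in between. Its reciprocal is a linear combination
  of the j-th powers of \<open>gam\<close> and of 1 / \<open>gam\<close>.\<close>

definition crossing_prob :: "nat \<Rightarrow> real" where
  "crossing_prob j = (gam + 1) * gam ^ j / (gam ^ (2 * j + 1) + 1)"

lemma gam_power_pos: "0 < gam ^ n" "0 < gam ^ n + 1"
  using gam_gt_1 by (simp_all add: add_pos_pos)

lemma advance_prob_0 [simp]: "advance_prob 0 = 1"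
  using gam_gt_1 by (simp add: advance_prob_def add.commute)

lemma crossing_prob_0 [simp]: "crossing_prob 0 = 1"
  using gam_gt_1 by (simp add: crossing_prob_def)

lemma advance_prob_pos: "0 < advance_prob j"
  unfolding advance_prob_def using gam_gt_1 by (intro divide_pos_pos add_pos_pos) auto

lemma crossing_prob_pos: "0 < crossing_prob j"
  unfolding crossing_prob_def using gam_gt_1 by (intro divide_pos_pos mult_pos_pos add_pos_pos) auto

lemma crossing_prob_Suc: "crossing_prob (Suc j) = advance_prob (Suc j) * crossing_prob j"
proof -
  have eq: "gam ^ (2 * Suc j) + gam = gam * (gam ^ (2 * j + 1) + 1)"
    by (simp add: algebra_simps)
  show ?thesis
    unfolding crossing_prob_def advance_prob_def eq
    using gam_power_pos(2)[of "2 * j + 1"] gam_power_pos(2)[of "2 * Suc j + 1"] by simp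
qed

text \<open>The first-step equation. It reduces to the quadratic equation of \<open>gam\<close>,
  used once in the form gam^2 = 3 gam - 1 and once in the form gam (3 - gam) = 1.\<close>

lemma advance_prob_Suc: "3 * advance_prob (Suc j) = 1 + advance_prob (Suc j) * advance_prob j"
proof -
  define x where "x = gam ^ (2 * j)"
  have x: "0 < x" unfolding x_def by (rule gam_power_pos)
  have y: "0 < x * gam + 1" "0 < x * gam ^ 3 + 1"
    using x gam_gt_1 by (auto intro!: add_pos_pos mult_pos_pos)
  have a: "advance_prob j = (x + gam) / (x * gam + 1)"
    by (simp add: advance_prob_def x_def mult.commute)
  have b: "advance_prob (Suc j) = gam * (x * gam + 1) / (x * gam ^ 3 + 1)"
    by (simp add: advance_prob_def x_def power3_eq_cube algebra_simps)
  have "3 - advance_prob j = (x * (3 * gam - 1) + (3 - gam)) / (x * gam + 1)"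
    unfolding a using y(1) by (simp add: field_simps)
  also have "gam * (x * (3 * gam - 1) + (3 - gam)) = x * gam ^ 3 + 1"
    unfolding gam_square[symmetric] using gam_square by (simp add: power3_eq_cube algebra_simps)
  then have "x * (3 * gam - 1) + (3 - gam) = (x * gam ^ 3 + 1) / gam"
    using gam_gt_1 by (simp add: field_simps)
  finally have "advance_prob (Suc j) * (3 - advance_prob j) = 1"
    unfolding b using y gam_gt_1 by simp
  then show ?thesis by (simp add: algebra_simps)
qed

lemma advance_prob_le_1: "advance_prob j \<le> 1"
proof (induction j)
  case (Suc j)
  then have "advance_prob (Suc j) * advance_prob j \<le> advance_prob (Suc j) * 1"
    using advance_prob_pos[of "Suc j"] by (intro mult_left_mono) auto
  then show ?case using advance_prob_Suc[of j] by simp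
qed simp

text \<open>The first-step equation would even give 1/2. The weaker 3/4 is the weight in
  \<open>run_weight\<close>: with 1/2 there, the supersolution inequality would leave no slack for z
  > 1.\<close>

lemma advance_prob_Suc_le: "advance_prob (Suc j) \<le> 3 / 4"
proof -
  have "advance_prob (Suc j) * advance_prob j \<le> advance_prob (Suc j) * 1"
    using advance_prob_pos[of "Suc j"] advance_prob_le_1[of j] by (intro mult_left_mono) auto
  then show ?thesis using advance_prob_Suc[of j] by simp
qed

lemma crossing_prob_le_1: "crossing_prob j \<le> 1"
proof (induction j)
  case (Suc j)
  have "advance_prob (Suc j) * crossing_prob j \<le> 1 * 1"
    using Suc advance_prob_le_1 crossing_prob_pos[of j] by (intro mult_mono) auto
  then show ?case by (simp add: crossing_prob_Suc)
qed simp

section \<open>Distance to the last wall and mean number of visits to walls\<close>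

definition wall_at :: "(int \<Rightarrow> bool) \<Rightarrow> int \<Rightarrow> nat \<Rightarrow> bool" where
  "wall_at r x j \<longleftrightarrow> \<not> r (x - int j) \<and> (\<forall>i<j. r (x - int i))"

text \<open>The value is meaningless if there is no wall at or to the left of \<open>x\<close>; such
  rows form a null set by \<open>AE_wall_exists\<close>.\<close>

definition wall_dist :: "(int \<Rightarrow> bool) \<Rightarrow> int \<Rightarrow> nat" where
  "wall_dist r x = (LEAST j. \<not> r (x - int j))"

lemma wall_at_0: "wall_at r x 0 \<longleftrightarrow> \<not> r x"
  by (simp add: wall_at_def)

lemma wall_at_Suc: "wall_at r x (Suc j) \<longleftrightarrow> r x \<and> wall_at r (x - 1) j"
proof -
  have "(\<forall>i<Suc j. r (x - int i)) \<longleftrightarrow> r x \<and> (\<forall>i<j. r (x - 1 - int i))"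
    by (simp add: All_less_Suc2 diff_diff_add)
  then show ?thesis by (auto simp: wall_at_def diff_diff_add)
qed

lemma wall_dist_eqI: "wall_at r x j \<Longrightarrow> wall_dist r x = j"
  unfolding wall_at_def wall_dist_def by (intro Least_equality) (auto simp: not_less[symmetric])

text \<open>The product is the probability of ever reaching x + k inside the row. The factor
  \<open>crossing_prob\<close> is the mean number of visits to the last wall after x + k is reached
  and before x + k + 1 is: that mean obeys the same recursion in the distance, with the same initial
  value, as the crossing probability.\<close>

definition visits :: "(int \<Rightarrow> bool) \<Rightarrow> int \<Rightarrow> ennreal" where
  "visits r x = (\<Sum>k. (\<Prod>i<k. ennreal (advance_prob (wall_dist r (x + int i)))) *
     ennreal (crossing_prob (wall_dist r (x + int k))))"

lemma visits_rec:
  "visits r x = ennreal (crossing_prob (wall_dist r x)) + ennreal (advance_prob (wall_dist r x)) * visits r (x + 1)"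
  unfolding visits_def
  by (rule suminf_prod_shift[of "\<lambda>x. ennreal (advance_prob (wall_dist r x))"
        "x" "\<lambda>x. ennreal (crossing_prob (wall_dist r x))"])

text \<open>The Poisson equation of the mean time in the row. Away from walls the constant 3 solves
  it and \<open>visits\<close> is harmonic for the killed walk; at a wall the constant is harmonic
  and \<open>visits\<close> supplies the unit of time.\<close>

lemma visits_equation:
  assumes walls: "\<And>y. \<exists>j. wall_at r y j"
  shows "3 + visits r x = 1 + row_op r (\<lambda>y. 3 + visits r y) x"
proof (cases "r x")
  case False
  then have "wall_dist r x = 0" by (intro wall_dist_eqI) (simp add: wall_at_0)
  then have "visits r x = 1 + visits r (x + 1)" by (subst visits_rec) simp
  then show ?thesis using False by (simp add: row_op_def add.left_commute)
next
  case True
  obtain j where j: "wall_at r (x - 1) j" using walls by blast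
  then have dist: "wall_dist r (x - 1) = j" "wall_dist r x = Suc j"
    using True by (auto intro!: wall_dist_eqI simp: wall_at_Suc)
  let ?a = "advance_prob (Suc j)" and ?q = "crossing_prob (Suc j)" and ?b = "advance_prob j" and ?c = "crossing_prob j"
  let ?v = "visits r (x + 1)"
  have vx: "visits r x = ennreal ?q + ennreal ?a * ?v"
    by (subst visits_rec) (simp add: dist)
  have vx1: "visits r (x - 1) = ennreal ?c + ennreal ?b * visits r x"
    by (subst visits_rec) (simp add: dist)
  note pos = advance_prob_pos[THEN less_imp_le] crossing_prob_pos[THEN less_imp_le]
  have a: "3 * ennreal ?a = 1 + ennreal ?b * ennreal ?a"
  proof -
    have "ennreal 3 * ennreal ?a = ennreal 1 + ennreal ?b * ennreal ?a"
      using advance_prob_Suc[of j] pos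
      by (simp add: ennreal_mult[symmetric] ennreal_plus[symmetric] mult.commute del: ennreal_plus ennreal_numeral ennreal_1)
    then show ?thesis by simp
  qed
  have q: "3 * ennreal ?q = ennreal ?c + ennreal ?b * ennreal ?q"
  proof -
    have "3 * ?q = ?c + ?b * ?q"
      unfolding crossing_prob_Suc using arg_cong[OF advance_prob_Suc[of j], of "\<lambda>t. t * ?c"]
      by (simp add: algebra_simps)
    then have "ennreal 3 * ennreal ?q = ennreal ?c + ennreal ?b * ennreal ?q"
      using pos
      by (simp add: ennreal_mult[symmetric] ennreal_plus[symmetric] del: ennreal_plus ennreal_numeral ennreal_1)
    then show ?thesis by simp
  qed
  \<comment> \<open>Both coefficients in the recursion of \<open>visits\<close> satisfy the
    first-step equation, hence \<open>visits\<close> does.\<close>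
  have "3 * visits r x = 3 * ennreal ?q + (3 * ennreal ?a) * ?v"
    by (simp add: vx distrib_left mult.assoc)
  also have "\<dots> = visits r (x - 1) + ?v"
    unfolding a q vx1 vx by (simp add: distrib_left distrib_right ac_simps)
  finally have v3: "3 * visits r x = visits r (x - 1) + ?v" .
  have "row_op r (\<lambda>y. 3 + visits r y) x = (6 + (visits r (x - 1) + ?v)) / 3"
    using True by (simp add: row_op_def ac_simps)
  also have "\<dots> = (3 * (2 + visits r x)) / 3"
    by (simp add: v3[symmetric] distrib_left)
  also have "\<dots> = 2 + visits r x"
    by (subst mult.commute, rule ennreal_mult_divide_eq) auto
  finally show ?thesis by (simp add: add.assoc[symmetric])
qed

lemma visits_expansion:
  assumes walls: "\<And>y. \<exists>j. wall_at r y j"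
  shows "3 + visits r x = (\<Sum>t<n. (row_op r ^^ t) (\<lambda>_. 1) x) + (row_op r ^^ n) (\<lambda>y. 3 + visits r y) x"
proof (induction n)
  case (Suc n)
  have "(row_op r ^^ n) (\<lambda>y. 3 + visits r y) x = (row_op r ^^ n) (\<lambda>y. 1 + row_op r (\<lambda>y. 3 + visits r y) y) x"
    by (subst visits_equation[OF walls]) simp
  also have "\<dots> = (row_op r ^^ n) (\<lambda>_. 1) x + (row_op r ^^ Suc n) (\<lambda>y. 3 + visits r y) x"
    by (simp add: row_op_funpow_add funpow_Suc_right del: funpow.simps)
  finally show ?case using Suc by (simp add: add.assoc)
qed simp

lemma visits_le_run_bound:
  assumes walls: "\<And>y. \<exists>j. wall_at r y j" and "1 \<le> z"
  shows "visits r x \<le> run_bound z r x"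
  unfolding visits_def run_bound_def
proof (intro suminf_le summableI)
  fix k
  have "ennreal (advance_prob (wall_dist r y)) \<le> run_weight z (r y)" for y
  proof -
    obtain j where j: "wall_at r y j" using walls by blast
    then have "wall_dist r y = j" by (rule wall_dist_eqI)
    moreover have "r y \<longleftrightarrow> j \<noteq> 0" using j by (cases j) (auto simp: wall_at_0 wall_at_Suc)
    ultimately show ?thesis
      using advance_prob_Suc_le[of "j - 1"] assms(2) by (cases j) (auto simp: run_weight_def intro!: ennreal_leI)
  qed
  then have "(\<Prod>i<k. ennreal (advance_prob (wall_dist r (x + int i)))) * ennreal (crossing_prob (wall_dist r (x + int k)))
      \<le> (\<Prod>i<k. run_weight z (r (x + int i))) * 1"
    using crossing_prob_le_1 by (intro mult_mono prod_mono_ennreal) (auto simp: ennreal_le_1)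
  then show "(\<Prod>i<k. ennreal (advance_prob (wall_dist r (x + int i)))) * ennreal (crossing_prob (wall_dist r (x + int k)))
      \<le> (\<Prod>i<k. run_weight z (r (x + int i)))" by simp
qed

text \<open>A solution of the Poisson equation is the mean time only if the mean of the solution
  after \<open>n\<close> steps tends to 0. Here that remainder is at most 4
  \<open>run_bound\<close>, transported by \<open>n\<close> steps, so it decays geometrically
  because z > 1.\<close>

lemma sum_stay_eq_visits:
  assumes walls: "\<And>y. \<exists>j. wall_at r y j" and z: "1 < z" "z \<le> 11 / 10" and fin: "run_bound z r x < \<infinity>"
  shows "(\<Sum>t. (row_op r ^^ t) (\<lambda>_. 1) x) = 3 + visits r x"
proof -
  let ?f = "\<lambda>t. (row_op r ^^ t) (\<lambda>_. 1) x"
  let ?R = "\<lambda>n. (row_op r ^^ n) (\<lambda>y. 3 + visits r y) x"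
  have le: "?R n \<le> 4 * run_bound z r x * ennreal ((1 / z) ^ n)" for n
  proof -
    have "3 + visits r y \<le> 4 * run_bound z r y" for y
    proof -
      have "3 + visits r y \<le> 3 * run_bound z r y + run_bound z r y"
        using z visits_le_run_bound[OF walls, of z y] mult_left_mono[OF run_bound_ge_1[of z r y], of 3]
        by (intro add_mono) auto
      also have "\<dots> = (3 + 1) * run_bound z r y" by (simp only: distrib_right mult_1)
      finally show ?thesis by simp
    qed
    then have "?R n \<le> (row_op r ^^ n) (\<lambda>y. 4 * run_bound z r y) x"
      by (rule row_op_funpow_mono)
    also have "\<dots> = 4 * (row_op r ^^ n) (run_bound z r) x"
      by (rule row_op_funpow_cmult)
    also have "(row_op r ^^ n) (run_bound z r) x = ennreal z ^ n * (row_op r ^^ n) (run_bound z r) x * ennreal ((1 / z) ^ n)"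
    proof -
      have "ennreal z ^ n * ennreal ((1 / z) ^ n) = ennreal (z ^ n * (1 / z) ^ n)"
        using z by (simp add: ennreal_power ennreal_mult)
      also have "z ^ n * (1 / z) ^ n = 1" using z by (simp add: power_mult_distrib[symmetric])
      finally have "(row_op r ^^ n) (run_bound z r) x =
          (row_op r ^^ n) (run_bound z r) x * (ennreal z ^ n * ennreal ((1 / z) ^ n))" by simp
      then show ?thesis by (simp only: ac_simps)
    qed
    also have "\<dots> \<le> run_bound z r x * ennreal ((1 / z) ^ n)"
      using z by (intro mult_right_mono run_bound_decay) auto
    finally show ?thesis by (simp add: mult.assoc mult_left_mono)
  qed
  have "4 * run_bound z r x < \<top>"
    using fin by (simp add: ennreal_mult_less_top)
  moreover have "(\<lambda>n. (1 / z) ^ n) \<longlonglongrightarrow> 0"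
    using z by (intro LIMSEQ_power_zero) simp
  ultimately have "(\<lambda>n. 4 * run_bound z r x * ennreal ((1 / z) ^ n)) \<longlonglongrightarrow> 4 * run_bound z r x * ennreal 0"
    by (intro ennreal_tendsto_cmult tendsto_ennrealI)
  then have lim: "(\<lambda>n. 4 * run_bound z r x * ennreal ((1 / z) ^ n)) \<longlonglongrightarrow> 0" by simp
  have "?R \<longlonglongrightarrow> 0"
    by (rule tendsto_sandwich[OF always_eventually always_eventually tendsto_const lim]) (simp_all add: le)
  moreover have "(\<lambda>n. \<Sum>t<n. ?f t) \<longlonglongrightarrow> (\<Sum>t. ?f t)"
    using summable_LIMSEQ[OF summableI, of ?f] .
  ultimately have "(\<lambda>n. (\<Sum>t<n. ?f t) + ?R n) \<longlonglongrightarrow> (\<Sum>t. ?f t) + 0"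
    by (intro tendsto_add)
  then have "(\<lambda>n. 3 + visits r x) \<longlonglongrightarrow> (\<Sum>t. ?f t)"
    unfolding visits_expansion[OF walls, symmetric] by simp
  then show ?thesis by (simp add: LIMSEQ_const_iff)
qed

section \<open>Averaging over the row\<close>

lemma wall_at_measurable [measurable]: "Measurable.pred (coin_space p) (\<lambda>r. wall_at r x j)"
  unfolding wall_at_def by measurable

lemma wall_dist_measurable [measurable]: "(\<lambda>r. wall_dist r x) \<in> coin_space p \<rightarrow>\<^sub>M count_space UNIV"
  unfolding wall_dist_def by measurable

lemma depends_on_wall_at: "depends_on {y. y \<le> x} (\<lambda>r. wall_at r x j)"
  unfolding wall_at_def by (intro depends_onI) (simp cong: all_cong)

lemma depends_on_wall_dist: "depends_on {y. y \<le> x} (\<lambda>r. wall_dist r x)"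
  unfolding wall_dist_def by (intro depends_onI) simp

lemma depends_on_comp: "depends_on S f \<Longrightarrow> depends_on S (\<lambda>w. g (f w))"
  unfolding depends_on_def by metis

context
  fixes p :: real
  assumes p: "0 < p" "p < 1"
begin

abbreviation row_space :: "(int \<Rightarrow> bool) measure" where "row_space \<equiv> coin_space p"

lemma nn_integral_mult_wall:
  assumes "f \<in> borel_measurable row_space" "depends_on {y. y < x} f"
  shows "(\<integral>\<^sup>+r. f r * of_bool (r x) \<partial>row_space) = ennreal p * (\<integral>\<^sup>+r. f r \<partial>row_space)"
    and "(\<integral>\<^sup>+r. f r * of_bool (\<not> r x) \<partial>row_space) = ennreal (1 - p) * (\<integral>\<^sup>+r. f r \<partial>row_space)"
proof -
  have *: "(\<integral>\<^sup>+r. f r * h (r x) \<partial>row_space) = (ennreal p * h True + ennreal (1 - p) * h False) * (\<integral>\<^sup>+r. f r \<partial>row_space)"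
    for h :: "bool \<Rightarrow> ennreal"
  proof -
    have "(\<integral>\<^sup>+r. f r * h (r x) \<partial>row_space) = (\<integral>\<^sup>+r. f r \<partial>row_space) * (\<integral>\<^sup>+r. h (r x) \<partial>row_space)"
      using assms by (intro nn_integral_coin_mult[where I = "{y. y < x}" and J = "{x}"]) (auto intro: depends_on_component)
    then show ?thesis
      using p by (simp add: nn_integral_coin_component mult.commute)
  qed
  show "(\<integral>\<^sup>+r. f r * of_bool (r x) \<partial>row_space) = ennreal p * (\<integral>\<^sup>+r. f r \<partial>row_space)"
    using *[of of_bool] by simp
  show "(\<integral>\<^sup>+r. f r * of_bool (\<not> r x) \<partial>row_space) = ennreal (1 - p) * (\<integral>\<^sup>+r. f r \<partial>row_space)"
    using *[of "\<lambda>b. of_bool (\<not> b)"] by simp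
qed

lemma nn_integral_wall_at: "(\<integral>\<^sup>+r. of_bool (wall_at r x j) \<partial>row_space) = ennreal (p ^ j * (1 - p))"
proof (induction j arbitrary: x)
  case 0
  interpret prob_space row_space by (rule prob_space_coin_space)
  show ?case
    using nn_integral_mult_wall(2)[of "\<lambda>_. 1" x] by (simp add: wall_at_0 depends_on_def emeasure_space_1[simplified])
next
  case (Suc j)
  have "(\<integral>\<^sup>+r. of_bool (wall_at r x (Suc j)) \<partial>row_space) = (\<integral>\<^sup>+r. of_bool (wall_at r (x - 1) j) * of_bool (r x) \<partial>row_space)"
    by (intro nn_integral_cong) (auto simp: wall_at_Suc)
  also have "\<dots> = ennreal p * (\<integral>\<^sup>+r. of_bool (wall_at r (x - 1) j) \<partial>row_space)"
    by (intro nn_integral_mult_wall(1) depends_on_comp[OF depends_on_mono[OF depends_on_wall_at]]) auto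
  also have "\<dots> = ennreal (p * (p ^ j * (1 - p)))"
    unfolding Suc.IH using p by (intro ennreal_mult[symmetric]) auto
  finally show ?case by (simp add: mult.assoc)
qed

text \<open>The probabilities \<open>p ^ j * (1 - p)\<close> of the disjoint events for the possible
  distances sum to 1.\<close>

lemma AE_wall_exists: "AE r in row_space. \<forall>x. \<exists>j. wall_at r x j"
  unfolding AE_all_countable
proof
  fix x
  interpret prob_space row_space by (rule prob_space_coin_space)
  have "(\<lambda>j. p ^ j * (1 - p)) sums (1 / (1 - p) * (1 - p))"
    using p by (intro sums_mult2 geometric_sums) auto
  then have s: "(\<lambda>j. p ^ j * (1 - p)) sums 1" using p by simp
  let ?A = "\<lambda>j. {r \<in> space row_space. wall_at r x j}"
  have A: "?A j \<in> sets row_space" for j by measurable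
  have "emeasure row_space (\<Union>j. ?A j) = (\<Sum>j. emeasure row_space (?A j))"
    using A by (intro suminf_emeasure[symmetric]) (auto simp: disjoint_family_on_def dest!: wall_dist_eqI)
  also have "\<dots> = (\<Sum>j. ennreal (p ^ j * (1 - p)))"
  proof -
    have "emeasure row_space (?A j) = (\<integral>\<^sup>+r. indicator (?A j) r \<partial>row_space)" for j
      by (intro nn_integral_indicator[symmetric]) measurable
    also have "\<dots> j = (\<integral>\<^sup>+r. of_bool (wall_at r x j) \<partial>row_space)" for j
      by (intro nn_integral_cong) (auto simp: indicator_def)
    finally show ?thesis by (simp only: nn_integral_wall_at)
  qed
  also have "\<dots> = ennreal 1"
    using s p by (intro sums_unique[symmetric] sums_ennreal[THEN iffD2]) auto
  finally have "emeasure row_space (\<Union>j. ?A j) = 1" by simp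
  then have "AE r in row_space. r \<in> (\<Union>j. ?A j)"
    using A by (intro AE_in_set_eq_1[THEN iffD2] sets.countable_UN) (auto simp: measure_def)
  then show "AE r in row_space. \<exists>j. wall_at r x j" by eventually_elim auto
qed

section \<open>The chain of wall distances, weighted by the probability of reaching a column\<close>

definition path_weight :: "nat \<Rightarrow> (int \<Rightarrow> bool) \<Rightarrow> ennreal" where
  "path_weight k r = (\<Prod>i<k. ennreal (advance_prob (wall_dist r (int i))))"

text \<open>Mass at distance \<open>j\<close> in column \<open>k\<close> of a killed Markov chain:
  from \<open>j\<close> it survives with probability \<open>advance_prob j\<close>, and then moves
  to 0 with probability 1 - p or to j + 1 with probability p, according to the coin of the next
  column.\<close>

definition wall_weight :: "nat \<Rightarrow> nat \<Rightarrow> ennreal" where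
  "wall_weight k j = (\<integral>\<^sup>+r. path_weight k r * of_bool (wall_at r (int k) j) \<partial>row_space)"

lemma path_weight_measurable [measurable]: "path_weight k \<in> borel_measurable row_space"
  unfolding path_weight_def by measurable

lemma depends_on_path_weight: "depends_on {y. y < int k} (path_weight k)"
  unfolding path_weight_def
proof (intro depends_onI prod.cong refl)
  fix w w' :: "int \<Rightarrow> bool" and i assume "\<And>y. y \<in> {y. y < int k} \<Longrightarrow> w y = w' y" "i \<in> {..<k}"
  then have "wall_dist w (int i) = wall_dist w' (int i)"
    by (intro depends_onD[OF depends_on_wall_dist]) auto
  then show "ennreal (advance_prob (wall_dist w (int i))) = ennreal (advance_prob (wall_dist w' (int i)))" by simp
qed

text \<open>Splitting by the value of the distance; almost surely at most one term of the series is
  nonzero.\<close>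

lemma nn_integral_path_weight:
  "(\<integral>\<^sup>+r. path_weight k r * g (wall_dist r (int k)) \<partial>row_space) = (\<Sum>j. g j * wall_weight k j)"
proof -
  have "(\<integral>\<^sup>+r. path_weight k r * g (wall_dist r (int k)) \<partial>row_space) =
      (\<integral>\<^sup>+r. (\<Sum>j. g j * (path_weight k r * of_bool (wall_at r (int k) j))) \<partial>row_space)"
  proof (rule nn_integral_cong_AE)
    show "AE r in row_space. path_weight k r * g (wall_dist r (int k)) =
        (\<Sum>j. g j * (path_weight k r * of_bool (wall_at r (int k) j)))"
      using AE_wall_exists
    proof eventually_elim
      case (elim r)
      then obtain j where j: "wall_at r (int k) j" by blast
      then have "wall_at r (int k) i \<longleftrightarrow> i = j" for i by (metis wall_dist_eqI)
      then have "(\<lambda>i. g i * (path_weight k r * of_bool (wall_at r (int k) i))) =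
          (\<lambda>i. if i = j then g j * path_weight k r else 0)"
        by auto
      then show ?case
        using wall_dist_eqI[OF j] sums_unique[OF sums_If_finite_set[of "{j}" "\<lambda>_. g j * path_weight k r"]]
        by (simp add: mult.commute)
    qed
  qed
  also have "\<dots> = (\<Sum>j. \<integral>\<^sup>+r. g j * (path_weight k r * of_bool (wall_at r (int k) j)) \<partial>row_space)"
    by (rule nn_integral_suminf) measurable
  also have "\<dots> = (\<Sum>j. g j * wall_weight k j)"
    unfolding wall_weight_def by (intro suminf_cong nn_integral_cmult) measurable
  finally show ?thesis .
qed

lemma wall_weight_0: "wall_weight 0 j = ennreal (p ^ j * (1 - p))"
  by (simp add: wall_weight_def path_weight_def nn_integral_wall_at)

lemma path_weight_Suc: "path_weight (Suc k) r = path_weight k r * ennreal (advance_prob (wall_dist r (int k)))"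
  by (simp add: path_weight_def)

lemma wall_weight_Suc_0:
  "wall_weight (Suc k) 0 = ennreal (1 - p) * (\<Sum>j. ennreal (advance_prob j) * wall_weight k j)"
proof -
  have "wall_weight (Suc k) 0 = ennreal (1 - p) * (\<integral>\<^sup>+r. path_weight (Suc k) r \<partial>row_space)"
    unfolding wall_weight_def wall_at_0
    by (intro nn_integral_mult_wall(2) depends_on_path_weight) measurable
  then show ?thesis
    using nn_integral_path_weight[of k "\<lambda>j. ennreal (advance_prob j)"] by (simp add: path_weight_Suc)
qed

lemma wall_weight_Suc_Suc:
  "wall_weight (Suc k) (Suc j) = ennreal p * ennreal (advance_prob j) * wall_weight k j"
proof -
  let ?f = "\<lambda>r. path_weight (Suc k) r * of_bool (wall_at r (int k) j)"
  have "wall_weight (Suc k) (Suc j) = (\<integral>\<^sup>+r. ?f r * of_bool (r (int (Suc k))) \<partial>row_space)"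
    unfolding wall_weight_def by (intro nn_integral_cong) (auto simp: wall_at_Suc)
  also have "\<dots> = ennreal p * (\<integral>\<^sup>+r. ?f r \<partial>row_space)"
    by (intro nn_integral_mult_wall(1) depends_on_mult depends_on_path_weight
        depends_on_comp[OF depends_on_mono[OF depends_on_wall_at]]) auto
  also have "(\<integral>\<^sup>+r. ?f r \<partial>row_space) =
      (\<integral>\<^sup>+r. ennreal (advance_prob j) * (path_weight k r * of_bool (wall_at r (int k) j)) \<partial>row_space)"
    by (intro nn_integral_cong) (auto simp: path_weight_Suc ac_simps dest: wall_dist_eqI)
  also have "\<dots> = ennreal (advance_prob j) * wall_weight k j"
    unfolding wall_weight_def by (intro nn_integral_cmult) measurable
  finally show ?thesis by (simp add: mult.assoc)
qed

text \<open>The Green function of the killed chain. Summing the transition rule over all columns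
  turns it into the stationary equations that follow.\<close>

definition total_weight :: "nat \<Rightarrow> ennreal" where
  "total_weight j = (\<Sum>k. wall_weight k j)"

lemma suminf_swap_ennreal: "(\<Sum>k. \<Sum>j. f k j) = (\<Sum>j. \<Sum>k. f k j :: ennreal)" for f :: "nat \<Rightarrow> nat \<Rightarrow> ennreal"
proof -
  have "(\<Sum>k. \<Sum>j. f k j) = (\<integral>\<^sup>+k. (\<Sum>j. f k j) \<partial>count_space UNIV)"
    by (simp add: nn_integral_count_space_nat)
  also have "\<dots> = (\<Sum>j. \<integral>\<^sup>+k. f k j \<partial>count_space UNIV)"
    by (rule nn_integral_suminf) simp
  finally show ?thesis by (simp add: nn_integral_count_space_nat)
qed

lemma suminf_split_head_ennreal: "(\<Sum>k. f k) = f 0 + (\<Sum>k. f (Suc k))" for f :: "nat \<Rightarrow> ennreal"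
  using suminf_offset[of f 1] by simp

lemma total_weight_0:
  "total_weight 0 = ennreal (1 - p) + ennreal (1 - p) * (\<Sum>j. ennreal (advance_prob j) * total_weight j)"
proof -
  have "total_weight 0 = ennreal (1 - p) + ennreal (1 - p) * (\<Sum>k. \<Sum>j. ennreal (advance_prob j) * wall_weight k j)"
    unfolding total_weight_def by (subst suminf_split_head_ennreal) (simp add: wall_weight_0 wall_weight_Suc_0)
  then show ?thesis
    by (subst (asm) suminf_swap_ennreal) (simp add: total_weight_def)
qed

lemma total_weight_Suc:
  "total_weight (Suc j) = ennreal (p ^ Suc j * (1 - p)) + ennreal p * ennreal (advance_prob j) * total_weight j"
  unfolding total_weight_def by (subst suminf_split_head_ennreal) (simp add: wall_weight_0 wall_weight_Suc_Suc)

lemma nn_integral_visits: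
  "(\<integral>\<^sup>+r. visits r 0 \<partial>row_space) = (\<Sum>j. ennreal (crossing_prob j) * total_weight j)"
proof -
  have "(\<integral>\<^sup>+r. visits r 0 \<partial>row_space) =
      (\<integral>\<^sup>+r. (\<Sum>k. path_weight k r * ennreal (crossing_prob (wall_dist r (int k)))) \<partial>row_space)"
    by (simp add: visits_def path_weight_def)
  also have "\<dots> = (\<Sum>k. \<integral>\<^sup>+r. path_weight k r * ennreal (crossing_prob (wall_dist r (int k))) \<partial>row_space)"
    by (rule nn_integral_suminf) measurable
  also have "\<dots> = (\<Sum>k. \<Sum>j. ennreal (crossing_prob j) * wall_weight k j)"
    using nn_integral_path_weight[of _ "\<lambda>j. ennreal (crossing_prob j)"] by (intro suminf_cong) simp
  also have "\<dots> = (\<Sum>j. \<Sum>k. ennreal (crossing_prob j) * wall_weight k j)"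
    by (rule suminf_swap_ennreal)
  finally show ?thesis by (simp add: total_weight_def)
qed

lemma visits_measurable [measurable]: "(\<lambda>r. visits r x) \<in> borel_measurable row_space"
  unfolding visits_def by measurable

text \<open>The stationary equations also admit infinite solutions; finiteness singles out the real
  one and allows division in the equation for the mass at distance 0.\<close>

lemma nn_integral_visits_finite: "(\<integral>\<^sup>+r. visits r 0 \<partial>row_space) < \<infinity>"
proof -
  have "(\<integral>\<^sup>+r. visits r 0 \<partial>row_space) \<le> (\<integral>\<^sup>+r. run_bound (1 + p / 10) r 0 \<partial>row_space)"
    by (rule nn_integral_mono_AE, rule AE_mp[OF AE_wall_exists], rule AE_I2)
       (use p in \<open>auto intro!: visits_le_run_bound\<close>)
  also have "\<dots> < \<infinity>" by (rule nn_integral_run_bound[OF p])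
  finally show ?thesis .
qed

lemma suminf_mean_depth_prob:
  "(\<Sum>t. mean_depth_prob p 0 t) = 3 + (\<integral>\<^sup>+r. visits r 0 \<partial>row_space)"
proof -
  interpret prob_space row_space by (rule prob_space_coin_space)
  have "(\<Sum>t. mean_depth_prob p 0 t) = (\<integral>\<^sup>+r. (\<Sum>t. (row_op r ^^ t) (\<lambda>_. 1) 0) \<partial>row_space)"
    unfolding mean_depth_prob_row by (rule nn_integral_suminf[symmetric]) measurable
  also have "\<dots> = (\<integral>\<^sup>+r. 3 + visits r 0 \<partial>row_space)"
  proof (rule nn_integral_cong_AE)
    have "AE r in row_space. run_bound (1 + p / 10) r 0 \<noteq> \<infinity>"
      using nn_integral_run_bound[OF p, of 0] by (intro nn_integral_noteq_infinite) auto
    then show "AE r in row_space. (\<Sum>t. (row_op r ^^ t) (\<lambda>_. 1) 0) = 3 + visits r 0"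
      using AE_wall_exists
    proof eventually_elim
      case (elim r)
      then show ?case
        using p by (intro sum_stay_eq_visits[of r "1 + p / 10"]) (auto simp: less_top)
    qed
  qed
  also have "\<dots> = 3 + (\<integral>\<^sup>+r. visits r 0 \<partial>row_space)"
    by (simp add: nn_integral_add emeasure_space_1[simplified])
  finally show ?thesis .
qed

end

section \<open>The mean time in closed form\<close>

text \<open>The closed form of \<open>crossing_prob\<close> extended to index -1 has the value 1,
  which makes \<open>crossing_prob_eq_prev\<close> valid at 0 as well.\<close>

definition prev_crossing_prob :: "nat \<Rightarrow> real" where
  "prev_crossing_prob j = (case j of 0 \<Rightarrow> 1 | Suc i \<Rightarrow> crossing_prob i)"

lemma crossing_prob_eq_prev: "crossing_prob j = advance_prob j * prev_crossing_prob j"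
  by (cases j) (simp_all add: prev_crossing_prob_def crossing_prob_Suc)

lemma prev_crossing_prob_pos: "0 < prev_crossing_prob j"
  by (cases j) (simp_all add: prev_crossing_prob_def crossing_prob_pos)

lemma prev_crossing_prob_Suc [simp]: "prev_crossing_prob (Suc j) = crossing_prob j"
  by (simp add: prev_crossing_prob_def)

text \<open>The reciprocals of the crossing probabilities are the Fibonacci numbers of odd index.\<close>
lemma inverse_crossing_prob_Suc:
  "1 / crossing_prob (Suc j) = 3 / crossing_prob j - 1 / prev_crossing_prob j"
proof -
  have pos: "0 < advance_prob (Suc j)" "0 < crossing_prob j" "0 < prev_crossing_prob j" "0 < advance_prob j"
    by (simp_all add: advance_prob_pos crossing_prob_pos prev_crossing_prob_pos)
  have "1 / advance_prob (Suc j) = 3 - advance_prob j"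
    using advance_prob_Suc[of j] pos by (simp add: field_simps)
  moreover have "1 / crossing_prob (Suc j) = (1 / advance_prob (Suc j)) / crossing_prob j"
    by (simp add: crossing_prob_Suc)
  moreover have "advance_prob j / crossing_prob j = 1 / prev_crossing_prob j"
    using pos by (simp add: crossing_prob_eq_prev)
  ultimately show ?thesis by (simp add: diff_divide_distrib)
qed

lemma crossing_prob_Theta_term: "crossing_prob j = (gam + 1) * (gam ^ j / (gam ^ (2 * j + 1) + 1))"
  by (simp add: crossing_prob_def)

text \<open>Partial fractions: summed against \<open>p ^ j\<close> this gives a geometric series and
  a multiple of \<open>Theta p\<close>.\<close>

lemma advance_prob_Theta_term: "advance_prob j = 1 / gam + (gam - 1 / gam) * (1 / (gam ^ (2 * j + 1) + 1))"
proof -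
  define x where "x = gam ^ (2 * j)"
  have y: "0 < x * gam + 1" using gam_gt_1 by (auto simp: x_def intro!: add_pos_pos mult_pos_pos)
  have x: "gam ^ (2 * j) = x" "gam ^ (2 * j + 1) = x * gam" by (simp_all add: x_def mult.commute)
  have "1 / gam + (gam - 1 / gam) * (1 / (x * gam + 1)) = (x + gam) / (x * gam + 1)"
    using y gam_gt_1 by (simp add: divide_simps) (simp add: algebra_simps)
  then show ?thesis
    by (simp only: advance_prob_def x)
qed

text \<open>Neighbouring terms 1 / (gam^(2 j + 1) + 1) differ by a multiple of this product, so that
  its generating series again involves only \<open>Theta p\<close>. The value gam / (gam + 1) is the
  term of index -1.\<close>

lemma crossing_prob_product:
  "crossing_prob j * prev_crossing_prob j =
     (gam + 1) / (gam - 1) * ((case j of 0 \<Rightarrow> gam / (gam + 1) | Suc i \<Rightarrow> 1 / (gam ^ (2 * i + 1) + 1)) - 1 / (gam ^ (2 * j + 1) + 1))"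
proof (cases j)
  case 0
  then show ?thesis using gam_gt_1 by (simp add: prev_crossing_prob_def diff_divide_distrib[symmetric])
next
  case (Suc i)
  define x where "x = gam ^ (2 * i)"
  have g: "gam ^ i * gam ^ i = x" "gam ^ (2 * i) = x" by (simp_all add: x_def power_add[symmetric] mult_2)
  have pos: "0 < x" "0 < x * gam + 1" "0 < x * gam * gam * gam + 1"
    using gam_gt_1 by (auto simp: x_def intro!: add_pos_pos mult_pos_pos)
  have "crossing_prob j * prev_crossing_prob j =
      (gam + 1) * (gam + 1) * (gam * x) / ((x * gam * gam * gam + 1) * (x * gam + 1))"
    by (simp add: Suc crossing_prob_def g(1)[symmetric] x_def[symmetric] mult_ac) (simp add: x_def power_add[symmetric] mult_2_right)
  also have "\<dots> = (gam + 1) / (gam - 1) * (1 / (x * gam + 1) - 1 / (x * gam * gam * gam + 1))"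
  proof -
    have "1 / (x * gam + 1) - 1 / (x * gam * gam * gam + 1) =
        x * gam * (gam - 1) * (gam + 1) / ((x * gam * gam * gam + 1) * (x * gam + 1))"
      using pos by (simp add: field_simps)
    then show ?thesis using gam_gt_1 by simp
  qed
  moreover have "gam ^ (2 * i + 1) = x * gam" "gam ^ (2 * Suc i + 1) = x * gam * gam * gam"
    by (simp_all add: x_def mult_ac)
  ultimately show ?thesis by (simp only: Suc nat.case)
qed

text \<open>The right-hand side of the velocity formula, to be identified with the mean time spent
  in a row.\<close>

definition velocity_time :: "real \<Rightarrow> real" where
  "velocity_time p = 4 - p - (5 + sqrt 5) / 2 * (1 - p)\<^sup>2 * Theta (p * gam)
         + (1 - p) * (3 + sqrt 5 - (1 - p) * (5 + sqrt 5) * Theta p)\<^sup>2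
           / ((3 + sqrt 5) * (2 - (1 - p) * (5 + sqrt 5) * Theta (p * gam)))"

context
  fixes p :: real
  assumes p: "0 < p" "p < 1"
begin

lemma Theta_sums:
  "(\<lambda>j. p ^ j * (1 / (gam ^ (2 * j + 1) + 1))) sums Theta p"
  "(\<lambda>j. p ^ j * (gam ^ j / (gam ^ (2 * j + 1) + 1))) sums Theta (p * gam)"
proof -
  have "p < 1 * gam" "p * gam < 1 * gam" "1 * gam < gam * gam"
    using p gam_gt_1 by (simp, intro mult_strict_right_mono, auto)
  then have "p < gam * gam" "p * gam < gam * gam" by linarith+
  then have "\<bar>p\<bar> < gam\<^sup>2" "\<bar>p * gam\<bar> < gam\<^sup>2"
    using p gam_gt_1 by (simp_all add: power2_eq_square abs_mult)
  note s = this[THEN summable_Theta, THEN summable_sums, folded Theta_def]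
  show "(\<lambda>j. p ^ j * (1 / (gam ^ (2 * j + 1) + 1))) sums Theta p"
    using s(1) by simp
  show "(\<lambda>j. p ^ j * (gam ^ j / (gam ^ (2 * j + 1) + 1))) sums Theta (p * gam)"
    using s(2) by (simp add: power_mult_distrib)
qed

abbreviation crossing_sum :: real where "crossing_sum \<equiv> (gam + 1) * Theta (p * gam)"
abbreviation product_sum :: real where "product_sum \<equiv> (gam - (1 - p) * (gam + 1) * Theta p) / (gam - 1)"

lemma crossing_sums: "(\<lambda>j. p ^ j * crossing_prob j) sums crossing_sum"
  using sums_mult[OF Theta_sums(2), of "gam + 1"] by (simp add: crossing_prob_Theta_term mult_ac)

lemma advance_sums: "(\<lambda>j. p ^ j * advance_prob j) sums (1 / gam / (1 - p) + (gam - 1 / gam) * Theta p)"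
proof -
  have "(\<lambda>j. 1 / gam * p ^ j + (gam - 1 / gam) * (p ^ j * (1 / (gam ^ (2 * j + 1) + 1)))) sums
      (1 / gam * (1 / (1 - p)) + (gam - 1 / gam) * Theta p)"
    using p by (intro sums_add sums_mult geometric_sums Theta_sums) auto
  then show ?thesis
    by (simp add: advance_prob_Theta_term algebra_simps)
qed

lemma prev_crossing_sums: "(\<lambda>j. p ^ j * prev_crossing_prob j) sums (1 + p * crossing_sum)"
proof -
  have "(\<lambda>j. p ^ Suc j * prev_crossing_prob (Suc j)) sums (p * crossing_sum)"
    using sums_mult[OF crossing_sums, of p] by (simp add: mult_ac)
  from sums_Suc[OF this] show ?thesis by (simp add: prev_crossing_prob_def add.commute)
qed

text \<open>Summation by parts: the differences of the shifted and the unshifted series leave -(1 -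
  p) \<open>Theta p\<close> and the boundary term at index 0.\<close>

lemma product_sums: "(\<lambda>j. p ^ j * (crossing_prob j * prev_crossing_prob j)) sums product_sum"
proof -
  let ?D = "\<lambda>j. case j of 0 \<Rightarrow> gam / (gam + 1) | Suc i \<Rightarrow> 1 / (gam ^ (2 * i + 1) + 1)"
  have "(\<lambda>j. p ^ Suc j * ?D (Suc j)) sums (p * Theta p)"
    using sums_mult[OF Theta_sums(1), of p] by (simp add: mult_ac)
  from sums_Suc[OF this] have "(\<lambda>j. p ^ j * ?D j) sums (p * Theta p + gam / (gam + 1))"
    by simp
  from sums_mult[OF sums_diff[OF this Theta_sums(1)], of "(gam + 1) / (gam - 1)"]
  have "(\<lambda>j. p ^ j * (crossing_prob j * prev_crossing_prob j)) sums
      ((gam + 1) / (gam - 1) * (p * Theta p + gam / (gam + 1) - Theta p))"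
    unfolding crossing_prob_product by (simp only: right_diff_distrib mult.left_commute)
  moreover have "(gam + 1) / (gam - 1) * (p * Theta p + gam / (gam + 1) - Theta p) = product_sum"
  proof -
    define X where "X = gam / (gam + 1)"
    have "(gam + 1) * X = gam" using gam_gt_1 by (simp add: X_def)
    then have "(gam + 1) * (p * Theta p + X - Theta p) = gam - (1 - p) * (gam + 1) * Theta p"
      by (simp add: algebra_simps)
    then show ?thesis by (simp add: X_def)
  qed
  ultimately show ?thesis by (simp only:)
qed

section \<open>Solving the stationary equations\<close>

lemma total_weight_finite: "total_weight p j < \<infinity>"
proof -
  have "ennreal (crossing_prob j) * total_weight p j \<le> (\<Sum>i. ennreal (crossing_prob i) * total_weight p i)"
    using sum_le_suminf[OF summableI, of "{j}" "\<lambda>i. ennreal (crossing_prob i) * total_weight p i"] by simp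
  also have "\<dots> < \<infinity>"
    using nn_integral_visits_finite[OF p] by (simp add: nn_integral_visits[OF p])
  finally show ?thesis
    using crossing_prob_pos[of j] by (auto simp: ennreal_mult_less_top)
qed

text \<open>Dividing the recursion by \<open>p ^ j * prev_crossing_prob j\<close> leaves a pure sum:
  the quotient grows by (1 - p) / \<open>crossing_prob j\<close>. The partial sums of 1 /
  \<open>crossing_prob j\<close> are in turn increments of the same sequence, as its second
  differences equal the sequence itself.\<close>

lemma total_weight_closed_form:
  defines "w0 \<equiv> enn2real (total_weight p 0)"
  shows "total_weight p j = ennreal (p ^ j * prev_crossing_prob j *
    (w0 + (1 - p) * (1 / crossing_prob j - 1 / prev_crossing_prob j)))"
    and "0 \<le> 1 / crossing_prob j - 1 / prev_crossing_prob j"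
proof -
  let ?r = "\<lambda>j. 1 / crossing_prob j - 1 / prev_crossing_prob j"
  have ge: "0 \<le> ?r j" for j
    using advance_prob_le_1[of j] prev_crossing_prob_pos[of j] advance_prob_pos[of j]
    by (simp add: crossing_prob_eq_prev field_simps)
  have w0: "0 \<le> w0" by (simp add: w0_def)
  show "0 \<le> ?r j" by (rule ge)
  show "total_weight p j = ennreal (p ^ j * prev_crossing_prob j * (w0 + (1 - p) * ?r j))"
  proof (induction j)
    case 0
    then show ?case
      using total_weight_finite[of 0] by (simp add: w0_def prev_crossing_prob_def)
  next
    case (Suc j)
    have nn: "0 \<le> p ^ j * prev_crossing_prob j * (w0 + (1 - p) * ?r j)" for j
      using p w0 ge[of j] prev_crossing_prob_pos[of j] by (intro mult_nonneg_nonneg add_nonneg_nonneg) auto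
    have "total_weight p (Suc j) = ennreal (p ^ Suc j * (1 - p)) +
        ennreal p * ennreal (advance_prob j) * ennreal (p ^ j * prev_crossing_prob j * (w0 + (1 - p) * ?r j))"
      by (simp only: total_weight_Suc[OF p] Suc.IH)
    also have "\<dots> = ennreal (p ^ Suc j * (1 - p) + p * advance_prob j * (p ^ j * prev_crossing_prob j * (w0 + (1 - p) * ?r j)))"
      using p nn[of j] advance_prob_pos[of j, THEN less_imp_le]
      by (subst ennreal_plus) (simp_all add: ennreal_mult del: ennreal_plus)
    also have "p ^ Suc j * (1 - p) + p * advance_prob j * (p ^ j * prev_crossing_prob j * (w0 + (1 - p) * ?r j)) =
        p ^ Suc j * crossing_prob j * (w0 + (1 - p) * (?r j + 1 / crossing_prob j))"
    proof -
      define R where "R = ?r j"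
      have "p ^ Suc j * crossing_prob j * (w0 + (1 - p) * (R + 1 / crossing_prob j)) =
          p ^ Suc j * (crossing_prob j * (w0 + (1 - p) * R) + (1 - p) * (crossing_prob j * (1 / crossing_prob j)))"
        by (simp only: algebra_simps)
      also have "\<dots> = p ^ Suc j * (crossing_prob j * (w0 + (1 - p) * R) + (1 - p))"
        using crossing_prob_pos[of j] by simp
      finally show ?thesis
        unfolding R_def[symmetric] by (simp add: crossing_prob_eq_prev algebra_simps)
    qed
    also have "?r j + 1 / crossing_prob j = ?r (Suc j)"
      by (simp add: inverse_crossing_prob_Suc)
    finally show ?case by simp
  qed
qed

text \<open>Functionals of the Green function are affine in the single unknown mass at 0. The choice
  \<open>h = advance_prob\<close> closes the equation for that unknown, and
  \<open>h = crossing_prob\<close> evaluates the visits to walls.\<close>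

lemma suminf_total_weight:
  assumes h: "\<And>j. 0 \<le> h j"
    and hq: "(\<lambda>j. p ^ j * (h j * prev_crossing_prob j)) sums a"
    and hr: "(\<lambda>j. p ^ j * (h j * (prev_crossing_prob j / crossing_prob j - 1))) sums b"
  shows "(\<Sum>j. ennreal (h j) * total_weight p j) = ennreal (enn2real (total_weight p 0) * a + (1 - p) * b)"
    and "0 \<le> enn2real (total_weight p 0) * a + (1 - p) * b"
proof -
  let ?w0 = "enn2real (total_weight p 0)"
  let ?t = "\<lambda>j. p ^ j * prev_crossing_prob j * (?w0 + (1 - p) * (1 / crossing_prob j - 1 / prev_crossing_prob j))"
  have nn: "0 \<le> ?t j" for j
    using p total_weight_closed_form(2)[of j] prev_crossing_prob_pos[of j]
    by (intro mult_nonneg_nonneg add_nonneg_nonneg) auto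
  have eq: "ennreal (h j) * total_weight p j = ennreal (h j * ?t j)" for j
    unfolding total_weight_closed_form(1)[of j] by (rule ennreal_mult[symmetric, OF h nn])
  have s: "(\<lambda>j. h j * ?t j) sums (?w0 * a + (1 - p) * b)"
  proof -
    have "h j * ?t j = ?w0 * (p ^ j * (h j * prev_crossing_prob j)) +
        (1 - p) * (p ^ j * (h j * (prev_crossing_prob j / crossing_prob j - 1)))" for j
      using prev_crossing_prob_pos[of j] crossing_prob_pos[of j] by (simp add: field_simps)
    then show ?thesis by (simp only:) (intro sums_add sums_mult hq hr)
  qed
  show pos: "0 \<le> ?w0 * a + (1 - p) * b"
    by (rule sums_le[OF _ sums_zero s]) (intro mult_nonneg_nonneg h nn)
  have "(\<lambda>j. ennreal (h j * ?t j)) sums ennreal (?w0 * a + (1 - p) * b)"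
    by (rule sums_ennreal[THEN iffD2, OF _ pos s]) (intro mult_nonneg_nonneg h nn)
  then show "(\<Sum>j. ennreal (h j) * total_weight p j) = ennreal (?w0 * a + (1 - p) * b)"
    unfolding eq by (rule sums_unique[symmetric])
qed

lemma suminf_stay_prob: "(\<Sum>t. mean_depth_prob p 0 t) = ennreal (velocity_time p)" and velocity_time_ge: "3 \<le> velocity_time p"
proof -
  let ?w0 = "enn2real (total_weight p 0)"
  let ?B = "1 / gam / (1 - p) + (gam - 1 / gam) * Theta p"
  have geo: "(\<lambda>j. p ^ j) sums (1 / (1 - p))" using p by (intro geometric_sums) auto
  have ratio: "advance_prob j * (prev_crossing_prob j / crossing_prob j - 1) = 1 - advance_prob j" 
    "crossing_prob j * (prev_crossing_prob j / crossing_prob j - 1) = prev_crossing_prob j - crossing_prob j" for j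
    using advance_prob_pos[of j] prev_crossing_prob_pos[of j] by (simp_all add: crossing_prob_eq_prev field_simps)
  have adv_nonneg: "0 \<le> advance_prob j" and cross_nonneg: "0 \<le> crossing_prob j" for j
    using advance_prob_pos crossing_prob_pos by (simp_all add: less_imp_le)
  have a1: "(\<lambda>j. p ^ j * (advance_prob j * prev_crossing_prob j)) sums crossing_sum"
    using crossing_sums by (simp only: crossing_prob_eq_prev)
  have a2: "(\<lambda>j. p ^ j * (advance_prob j * (prev_crossing_prob j / crossing_prob j - 1))) sums (1 / (1 - p) - ?B)"
    using sums_diff[OF geo advance_sums] by (simp only: ratio) (simp only: right_diff_distrib mult_1_right)
  note adv = suminf_total_weight[OF adv_nonneg a1 a2]
  have v2: "(\<lambda>j. p ^ j * (crossing_prob j * (prev_crossing_prob j / crossing_prob j - 1))) sums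
      (1 + p * crossing_sum - crossing_sum)"
    using sums_diff[OF prev_crossing_sums crossing_sums] by (simp only: ratio) (simp only: right_diff_distrib)
  note vis = suminf_total_weight[OF cross_nonneg product_sums v2]
  define A where "A = ?w0 * crossing_sum + (1 - p) * (1 / (1 - p) - ?B)"
  define V where "V = ?w0 * product_sum + (1 - p) * (1 + p * crossing_sum - crossing_sum)"
  note adv = adv[folded A_def] and vis = vis[folded V_def]
  \<comment> \<open>The stationary equation at distance 0; \<open>A\<close> is itself affine in
    \<open>?w0\<close>, so this is a linear equation for \<open>?w0\<close>.\<close>
  have w0: "?w0 = (1 - p) + (1 - p) * A"
  proof -
    have "ennreal ?w0 = total_weight p 0"
      using total_weight_finite[of 0] by simp
    also have "\<dots> = ennreal (1 - p) + ennreal (1 - p) * ennreal A"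
      using total_weight_0[OF p] by (simp only: adv(1))
    also have "\<dots> = ennreal ((1 - p) + (1 - p) * A)"
      using p adv(2) by (simp add: ennreal_mult)
    finally show ?thesis
      using p adv(2) by (subst (asm) ennreal_inj) auto
  qed
  define s t D K where "s = Theta (p * gam)" and "t = Theta p" and "D = 1 - (1 - p) * (gam + 1) * s"
    and "K = (gam - (1 - p) * (gam + 1) * t) / (gam - 1)"
  have sqrt5: "sqrt 5 = 2 * gam - 3" by (simp add: gam_def field_simps)
  \<comment> \<open>\<open>D\<close> is half the denominator of the velocity formula and also the
    factor of \<open>?w0\<close> in the linear equation.\<close>
  have D: "0 < D"
    using velocity_denominator_pos[OF p] by (simp add: sqrt5 D_def s_def algebra_simps)
  \<comment> \<open>The constant term of the linear equation turns out to be 1 - p times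
    \<open>product_sum\<close>, the very factor that multiplies \<open>?w0\<close> in
    \<open>V\<close>. This coincidence is the origin of the square in the formula.\<close>
  have K: "1 + (1 - p) * (1 / (1 - p) - ?B) = K"
  proof -
    have cube: "gam * (gam * gam) = 8 * gam - 3"
      unfolding gam_square using gam_square by (simp add: algebra_simps)
    have "(gam - 1) * (2 - 1 / gam) = gam" "(gam - 1) * (gam - 1 / gam) = gam + 1"
      using gam_gt_1 gam_square cube by (simp_all add: field_simps)
    then have "2 - 1 / gam = gam / (gam - 1)" "gam - 1 / gam = (gam + 1) / (gam - 1)"
      using gam_gt_1 by (simp_all add: eq_divide_eq mult.commute)
    moreover have "1 + (1 - p) * (1 / (1 - p) - ?B) = (2 - 1 / gam) - (1 - p) * ((gam - 1 / gam) * t)"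
    proof -
      have "(1 - p) * (1 / (1 - p)) = 1" "(1 - p) * (1 / gam / (1 - p)) = 1 / gam"
        using p by (simp, subst times_divide_eq_right, intro nonzero_mult_div_cancel_left, simp)
      then show ?thesis by (simp only: t_def right_diff_distrib distrib_left)
    qed
    ultimately show ?thesis by (simp add: K_def diff_divide_distrib mult.assoc)
  qed
  have "?w0 = (1 - p) * K + (1 - p) * (?w0 * crossing_sum)"
    using w0 unfolding A_def K[symmetric] by (simp add: algebra_simps)
  then have "?w0 * D = (1 - p) * K"
    by (simp add: D_def s_def algebra_simps)
  then have w0': "?w0 = (1 - p) * K / D"
    using D by (simp add: field_simps)
  have "V = (1 - p) * K / D * K + (1 - p) * D"
    unfolding V_def w0' by (simp add: D_def K_def s_def t_def algebra_simps)
  also have "(1 - p) * K / D * K = (1 - p) * (2 * gam - (1 - p) * (2 * gam + 2) * t)\<^sup>2 / (2 * gam * (2 * D))"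
  proof -
    have "K * (gam - 1) = gam - (1 - p) * (gam + 1) * t"
      using gam_gt_1 by (simp add: K_def)
    then have "2 * gam - (1 - p) * (2 * gam + 2) * t = 2 * (K * (gam - 1))"
      by (simp add: algebra_simps)
    then have "(2 * gam - (1 - p) * (2 * gam + 2) * t)\<^sup>2 = 4 * K * K * ((gam - 1) * (gam - 1))"
      by (simp only: power2_eq_square) (simp add: algebra_simps)
    \<comment> \<open>The quadratic equation of \<open>gam\<close> again; it turns the squared
      denominator of \<open>K\<close> into the factor 3 + sqrt 5 = 2 gam.\<close>
    also have "(gam - 1) * (gam - 1) = gam" using gam_square by (simp add: algebra_simps)
    finally show ?thesis using gam_gt_1 by simp
  qed
  finally have "V = (1 - p) * (2 * gam - (1 - p) * (2 * gam + 2) * t)\<^sup>2 / (2 * gam * (2 * D)) + (1 - p) * D" .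
  moreover have "velocity_time p = 4 - p - (gam + 1) * (1 - p)\<^sup>2 * s +
      (1 - p) * (2 * gam - (1 - p) * (2 * gam + 2) * t)\<^sup>2 / (2 * gam * (2 * D))"
  proof -
    have "3 + sqrt 5 = 2 * gam" "5 + sqrt 5 = 2 * gam + 2" "(2 * gam + 2) / 2 = gam + 1"
      "2 - (1 - p) * (2 * gam + 2) * s = 2 * D"
      by (simp_all add: sqrt5 D_def algebra_simps)
    then show ?thesis by (simp only: velocity_time_def s_def[symmetric] t_def[symmetric])
  qed
  moreover have "3 + (1 - p) * D = 4 - p - (gam + 1) * (1 - p)\<^sup>2 * s"
    by (simp add: D_def algebra_simps power2_eq_square)
  ultimately have V: "3 + V = velocity_time p" by linarith
  show "3 \<le> velocity_time p"
    using vis(2) V by simp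
  have "(\<Sum>t. mean_depth_prob p 0 t) = 3 + ennreal V"
    by (simp only: suminf_mean_depth_prob[OF p] nn_integral_visits[OF p] vis(1))
  also have "\<dots> = ennreal (3 + V)"
    using vis(2) by simp
  finally show "(\<Sum>t. mean_depth_prob p 0 t) = ennreal (velocity_time p)"
    by (simp only: V)
qed

end

section \<open>Large deviation bounds\<close>

definition stay_gf :: "real \<Rightarrow> real \<Rightarrow> real" where
  "stay_gf p z = (\<Sum>n. stay_prob p n * z ^ n)"

text \<open>Generating function of the exit time, written by summation by parts through its tails.
  In this form its derivative at 1 is visibly \<open>stay_gf p 1\<close>, the mean.\<close>

definition exit_gf :: "real \<Rightarrow> real \<Rightarrow> real" where
  "exit_gf p z = 1 + (z - 1) * stay_gf p z"

lemma mean_exit_prob_eq: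
  "mean_exit_prob p n = ennreal (stay_prob p n - stay_prob p (Suc n))"
  "stay_prob p (Suc n) \<le> stay_prob p n"
proof -
  have eq: "ennreal (stay_prob p n) = ennreal (stay_prob p (Suc n)) + mean_exit_prob p n"
    unfolding ennreal_stay_prob by (rule mean_depth_prob_stay_exit)
  have fin: "mean_exit_prob p n \<noteq> \<top>"
  proof
    assume "mean_exit_prob p n = \<top>"
    with eq show False by simp
  qed
  then obtain e where e: "mean_exit_prob p n = ennreal e" "0 \<le> e"
    by (cases "mean_exit_prob p n") auto
  then have "ennreal (stay_prob p n) = ennreal (stay_prob p (Suc n) + e)"
    using eq stay_prob_nonneg[of p "Suc n"] by simp
  then have "stay_prob p n = stay_prob p (Suc n) + e"
    using stay_prob_nonneg[of p "Suc n"] stay_prob_nonneg[of p n] e by (subst (asm) ennreal_inj) auto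
  then show "mean_exit_prob p n = ennreal (stay_prob p n - stay_prob p (Suc n))" "stay_prob p (Suc n) \<le> stay_prob p n"
    using e by simp_all
qed

context
  fixes p :: real
  assumes p: "0 < p" "p < 1"
begin

lemma summable_stay_gf:
  assumes "\<bar>z\<bar> < 1 + p / 10"
  shows "summable (\<lambda>n. stay_prob p n * z ^ n)"
proof -
  obtain C where C: "\<And>n. stay_prob p n * (1 + p / 10) ^ n \<le> C"
    using stay_prob_decay[OF p] by blast
  let ?R = "1 + p / 10"
  have R: "0 < ?R" using p by simp
  show ?thesis
  proof (rule summable_comparison_test')
    show "summable (\<lambda>n. C * (\<bar>z\<bar> / ?R) ^ n)"
      using assms R by (intro summable_mult summable_geometric) simp
    fix n :: nat
    have "norm (stay_prob p n * z ^ n) = stay_prob p n * ?R ^ n * (\<bar>z\<bar> / ?R) ^ n"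
      using R stay_prob_nonneg[of p n] by (simp add: abs_mult power_abs power_divide)
    also have "\<dots> \<le> C * (\<bar>z\<bar> / ?R) ^ n"
      using C R by (intro mult_right_mono) auto
    finally show "norm (stay_prob p n * z ^ n) \<le> C * (\<bar>z\<bar> / ?R) ^ n" .
  qed
qed

lemma stay_gf_1: "stay_gf p 1 = velocity_time p"
proof -
  have "ennreal (\<Sum>t. stay_prob p t) = (\<Sum>t. ennreal (stay_prob p t))"
    using summable_stay_gf[of 1] p by (intro suminf_ennreal2[symmetric] stay_prob_nonneg) auto
  also have "\<dots> = ennreal (velocity_time p)"
    by (simp only: ennreal_stay_prob suminf_stay_prob[OF p])
  finally have "(\<Sum>t. stay_prob p t) = velocity_time p"
    using velocity_time_ge[OF p] summable_stay_gf[of 1] p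
    by (subst (asm) ennreal_inj) (auto intro!: suminf_nonneg stay_prob_nonneg)
  then show ?thesis by (simp add: stay_gf_def)
qed

lemma exit_gf_1: "exit_gf p 1 = 1"
  by (simp add: exit_gf_def)

lemma DERIV_exit_gf: "(exit_gf p has_real_derivative velocity_time p) (at 1)"
proof -
  \<comment> \<open>An auxiliary point strictly between 1 and 1 + p/10, needed to differentiate the
    power series at 1.\<close>
  have "summable (\<lambda>n. stay_prob p n * (1 + p / 20) ^ n)"
    using p by (intro summable_stay_gf) simp
  then have "DERIV (\<lambda>x. \<Sum>n. stay_prob p n * x ^ n) 1 :> (\<Sum>n. diffs (stay_prob p) n * 1 ^ n)"
    using p by (intro termdiffs_strong) auto
  then have d: "DERIV (stay_gf p) 1 :> (\<Sum>n. diffs (stay_prob p) n * 1 ^ n)"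
    unfolding stay_gf_def[abs_def] .
  show ?thesis
    unfolding exit_gf_def[abs_def] by (auto intro!: derivative_eq_intros d simp: stay_gf_1)
qed

lemma exit_gf_sums:
  assumes "\<bar>z\<bar> < 1 + p / 10"
  shows "(\<lambda>i. (stay_prob p i - stay_prob p (Suc i)) * z ^ Suc i) sums exit_gf p z"
proof -
  have s: "(\<lambda>n. stay_prob p n * z ^ n) sums stay_gf p z"
    unfolding stay_gf_def using summable_stay_gf[OF assms] by (rule summable_sums)
  have "(\<lambda>n. stay_prob p (Suc n) * z ^ Suc n) sums (stay_gf p z - 1)"
    using s by (subst sums_Suc_iff) (simp add: stay_prob_0)
  from sums_diff[OF sums_mult[OF s, of z] this] show ?thesis
    by (simp add: exit_gf_def algebra_simps)
qed

lemma stay_gf_nonneg: "0 \<le> z \<Longrightarrow> z < 1 + p / 10 \<Longrightarrow> 0 \<le> stay_gf p z"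
  unfolding stay_gf_def
  by (intro suminf_nonneg summable_stay_gf mult_nonneg_nonneg stay_prob_nonneg) auto

text \<open>The Chernoff bound for \<open>k\<close> completed sojourns followed by an unfinished
  one; induction along the convolution replaces the sojourn times themselves.\<close>

lemma mean_depth_prob_le:
  assumes z: "0 < z" "z < 1 + p / 10"
  shows "mean_depth_prob p k n \<le> ennreal (stay_gf p z * exit_gf p z ^ k / z ^ n)"
proof (induction k arbitrary: n)
  case 0
  have "stay_prob p n * z ^ n \<le> stay_gf p z"
    unfolding stay_gf_def
    using sum_le_suminf[OF summable_stay_gf, of z "{n}"] z stay_prob_nonneg by simp
  then have "stay_prob p n \<le> stay_gf p z / z ^ n"
    using z by (simp add: pos_le_divide_eq)
  then show ?case by (simp add: ennreal_stay_prob[symmetric] ennreal_leI)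
next
  case (Suc k)
  let ?e = "\<lambda>i. stay_prob p i - stay_prob p (Suc i)"
  let ?c = "stay_gf p z * exit_gf p z ^ k"
  have e: "0 \<le> ?e i" for i using mean_exit_prob_eq(2)[of p i] by simp
  have sum_le: "(\<Sum>i<n. ?e i * z ^ Suc i) \<le> exit_gf p z"
  proof -
    have s: "(\<lambda>i. ?e i * z ^ Suc i) sums exit_gf p z" using z by (intro exit_gf_sums) simp
    have "(\<Sum>i<n. ?e i * z ^ Suc i) \<le> (\<Sum>i. ?e i * z ^ Suc i)"
      using z by (intro sum_le_suminf sums_summable[OF s] mult_nonneg_nonneg e) auto
    then show ?thesis by (simp only: sums_unique[OF s])
  qed
  have "0 \<le> exit_gf p z"
    using exit_gf_sums[of z] z e by (intro sums_le[OF _ sums_zero exit_gf_sums]) auto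
  then have c: "0 \<le> ?c" using z by (intro mult_nonneg_nonneg stay_gf_nonneg) auto
  have "mean_depth_prob p (Suc k) n \<le> (\<Sum>i<n. ennreal (?e i) * ennreal (?c / z ^ (n - 1 - i)))"
    unfolding mean_depth_prob_Suc mean_exit_prob_eq by (intro sum_mono mult_left_mono Suc.IH) auto
  also have "\<dots> = ennreal (\<Sum>i<n. ?e i * (?c / z ^ (n - 1 - i)))"
    using e c z by (simp add: ennreal_mult[symmetric] sum_ennreal)
  also have "(\<Sum>i<n. ?e i * (?c / z ^ (n - 1 - i))) = ?c / z ^ n * (\<Sum>i<n. ?e i * z ^ Suc i)"
    unfolding sum_distrib_left
  proof (intro sum.cong refl)
    fix i assume "i \<in> {..<n}"
    then have "z ^ n = z ^ (n - 1 - i) * z ^ Suc i"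
      by (simp add: power_add[symmetric] del: power_Suc)
    then show "?e i * (?c / z ^ (n - 1 - i)) = ?c / z ^ n * (?e i * z ^ Suc i)"
      using z by (simp del: power_Suc)
  qed
  also have "ennreal \<dots> \<le> ennreal (?c / z ^ n * exit_gf p z)"
    using sum_le c z by (intro ennreal_leI mult_left_mono) auto
  finally show ?case by (simp add: mult_ac)
qed

text \<open>The sign condition permits replacing \<open>k\<close> by c n in the exponent, whether
  \<open>exit_gf p z\<close> is above or below 1, and so serves both tails.\<close>

lemma mean_depth_prob_exp_bound:
  assumes z: "0 < z" "z < 1 + p / 10" and pos: "0 < exit_gf p z"
    and k: "(real k - c * real n) * ln (exit_gf p z) \<le> 0"
  shows "mean_depth_prob p k n \<le> ennreal (stay_gf p z * exp (c * ln (exit_gf p z) - ln z) ^ n)"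
proof -
  have "exit_gf p z ^ k = exp (real k * ln (exit_gf p z))"
    using pos by (simp add: exp_of_nat_mult)
  also have "\<dots> \<le> exp (real n * (c * ln (exit_gf p z)))"
    using k by (simp add: algebra_simps)
  finally have "exit_gf p z ^ k / z ^ n \<le> exp (real n * (c * ln (exit_gf p z))) / z ^ n"
    using z by (intro divide_right_mono) auto
  also have "\<dots> = exp (c * ln (exit_gf p z) - ln z) ^ n"
    using z by (simp add: exp_of_nat_mult exp_diff power_divide)
  finally have "stay_gf p z * (exit_gf p z ^ k / z ^ n) \<le> stay_gf p z * exp (c * ln (exit_gf p z) - ln z) ^ n"
    using z by (intro mult_left_mono stay_gf_nonneg) auto
  then show ?thesis
    using mean_depth_prob_le[OF z, of k n] by (auto intro: order_trans ennreal_leI)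
qed

lemma DERIV_rate:
  "((\<lambda>z. c * ln (exit_gf p z) - ln z) has_real_derivative (c * velocity_time p - 1)) (at 1)"
  by (auto intro!: derivative_eq_intros DERIV_exit_gf simp: exit_gf_1)

lemma mean_depth_prob_lower_tail:
  assumes c: "c * velocity_time p < 1"
  obtains C \<rho> where "0 \<le> C" "0 \<le> \<rho>" "\<rho> < 1"
    "\<And>k n. real k \<le> c * real n \<Longrightarrow> mean_depth_prob p k n \<le> ennreal (C * \<rho> ^ n)"
proof -
  from DERIV_neg_dec_right[OF DERIV_rate[of c]] c obtain d where d: "0 < d"
    "\<And>h. 0 < h \<Longrightarrow> h < d \<Longrightarrow> c * ln (exit_gf p (1 + h)) - ln (1 + h) < c * ln (exit_gf p 1) - ln 1"
    by auto
  \<comment> \<open>Too small a depth means that the rows took too long, so z > 1 is the right side;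
    \<open>h\<close> must also stay inside the radius of convergence.\<close>
  define h where "h = min d (p / 10) / 2"
  have h: "0 < h" "h < d" "h < p / 10" using d p by (auto simp: h_def)
  let ?z = "1 + h"
  have "1 * 1 \<le> exit_gf p ?z"
    unfolding exit_gf_def using h stay_gf_nonneg[of ?z] by simp
  then have ge: "1 \<le> exit_gf p ?z" by simp
  show ?thesis
  proof
    show "0 \<le> stay_gf p ?z" using h by (intro stay_gf_nonneg) auto
    show "exp (c * ln (exit_gf p ?z) - ln ?z) < 1" using d(2)[OF h(1,2)] by (simp add: exit_gf_1)
    fix k n assume "real k \<le> c * real n"
    then show "mean_depth_prob p k n \<le> ennreal (stay_gf p ?z * exp (c * ln (exit_gf p ?z) - ln ?z) ^ n)"
      using h ge by (intro mean_depth_prob_exp_bound mult_nonpos_nonneg) auto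
  qed simp
qed

lemma mean_depth_prob_upper_tail:
  assumes c: "1 < c * velocity_time p"
  obtains C \<rho> where "0 \<le> C" "0 \<le> \<rho>" "\<rho> < 1"
    "\<And>k n. c * real n \<le> real k \<Longrightarrow> mean_depth_prob p k n \<le> ennreal (C * \<rho> ^ n)"
proof -
  from DERIV_pos_inc_left[OF DERIV_rate[of c]] c obtain d where d: "0 < d"
    "\<And>h. 0 < h \<Longrightarrow> h < d \<Longrightarrow> c * ln (exit_gf p (1 - h)) - ln (1 - h) < c * ln (exit_gf p 1) - ln 1"
    by auto
  have "isCont (exit_gf p) 1" using DERIV_exit_gf by (rule DERIV_isCont)
  then have "(exit_gf p \<longlongrightarrow> 1) (at 1)" by (simp add: isCont_def exit_gf_1)
  then have "eventually (\<lambda>z. 0 < exit_gf p z) (at 1)" by (rule order_tendstoD) simp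
  then obtain d' where d': "0 < d'" "\<And>z. z \<noteq> 1 \<Longrightarrow> dist z 1 < d' \<Longrightarrow> 0 < exit_gf p z"
    unfolding eventually_at by auto
  \<comment> \<open>Too large a depth means that the rows were left too fast, so z < 1; besides the
    rate, both \<open>z\<close> and \<open>exit_gf p z\<close> have to stay positive for their
    logarithms.\<close>
  define h where "h = min d (min d' 1) / 2"
  have h: "0 < h" "h < d" "h < 1" "h < d'" using d d' by (auto simp: h_def)
  let ?z = "1 - h"
  have pos: "0 < exit_gf p ?z" using h by (intro d') (auto simp: dist_real_def)
  have "exit_gf p ?z \<le> 1"
    unfolding exit_gf_def using h p stay_gf_nonneg[of ?z] by simp
  then have le: "ln (exit_gf p ?z) \<le> 0" using pos by simp
  show ?thesis
  proof
    show "0 \<le> stay_gf p ?z" using h p by (intro stay_gf_nonneg) auto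
    show "exp (c * ln (exit_gf p ?z) - ln ?z) < 1" using d(2)[OF h(1,2)] by (simp add: exit_gf_1)
    fix k n assume "c * real n \<le> real k"
    then show "mean_depth_prob p k n \<le> ennreal (stay_gf p ?z * exp (c * ln (exit_gf p ?z) - ln ?z) ^ n)"
      using h p pos le by (intro mean_depth_prob_exp_bound mult_nonneg_nonpos) auto
  qed simp
qed

end

section \<open>An exponential supermartingale for the first coordinate, in every environment\<close>

lemma walk_op_mono: "(\<And>s. f s \<le> g s) \<Longrightarrow> walk_op w f s \<le> walk_op w g s"
  unfolding walk_op_def by (cases "w s") (simp_all add: divide_right_mono_ennreal add_mono)

lemma walk_op_funpow_mono: "(\<And>s. f s \<le> g s) \<Longrightarrow> (walk_op w ^^ n) f s \<le> (walk_op w ^^ n) g s"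
  by (induction n arbitrary: s) (simp_all add: walk_op_mono)

lemma walk_op_cmult: "walk_op w (\<lambda>s. c * f s) s = c * walk_op w f s"
  by (auto simp: walk_op_def distrib_left ennreal_times_divide)

lemma walk_op_funpow_cmult: "(walk_op w ^^ n) (\<lambda>s. c * f s) s = c * (walk_op w ^^ n) f s"
proof (induction n arbitrary: s)
  case (Suc n)
  then have "(walk_op w ^^ n) (\<lambda>s. c * f s) = (\<lambda>s. c * (walk_op w ^^ n) f s)" by blast
  then show ?case by (simp add: walk_op_cmult)
qed simp

lemma walk_op_sum: "walk_op w (\<lambda>s. \<Sum>k\<in>K. f k s) s = (\<Sum>k\<in>K. walk_op w (f k) s)"
  by (induction K rule: infinite_finite_induct)
     (auto simp: walk_op_def add_divide_distrib_ennreal ac_simps)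

lemma walk_op_funpow_sum:
  "(walk_op w ^^ n) (\<lambda>s. \<Sum>k\<in>K. f k s) s = (\<Sum>k\<in>K. (walk_op w ^^ n) (f k) s)"
proof (induction n arbitrary: s)
  case (Suc n)
  then have "(walk_op w ^^ n) (\<lambda>s. \<Sum>k\<in>K. f k s) = (\<lambda>s. \<Sum>k\<in>K. (walk_op w ^^ n) (f k) s)" by blast
  then show ?case by (simp add: walk_op_sum)
qed simp

text \<open>Moment generating function of the increment of x - 3 y - n away from walls, which is 0,
  -2 or 2 with equal probability. The coefficient 3 balances the mean descent 1/3 against the unit
  of time. At a wall the increment is 0.\<close>

definition drift_mgf :: "real \<Rightarrow> real" where
  "drift_mgf \<theta> = (1 + exp (2 * \<theta>) + exp (- 2 * \<theta>)) / 3"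

definition tilt :: "real \<Rightarrow> site \<Rightarrow> ennreal" where
  "tilt \<theta> s = ennreal (exp (\<theta> * (real_of_int (fst s) - 3 * real_of_int (snd s))))"

lemma drift_mgf_ge_1: "1 \<le> drift_mgf \<theta>"
proof -
  have "0 \<le> (exp \<theta> - exp (- \<theta>))\<^sup>2" by simp
  also have "(exp \<theta> - exp (- \<theta>))\<^sup>2 = exp (2 * \<theta>) + exp (- 2 * \<theta>) - 2"
    by (simp add: power2_eq_square algebra_simps exp_add[symmetric])
  finally show ?thesis by (simp add: drift_mgf_def)
qed

text \<open>Time is not part of \<open>tilt\<close>, hence the factor \<open>exp \<theta>\<close>
  per step; at a wall the bound needs only \<open>drift_mgf_ge_1\<close>.\<close>

lemma walk_op_tilt: "walk_op w (tilt \<theta>) s \<le> ennreal (exp \<theta> * drift_mgf \<theta>) * tilt \<theta> s"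
proof -
  define E where "E = exp (\<theta> * (real_of_int (fst s) - 3 * real_of_int (snd s)))"
  have E: "0 < E" by (simp add: E_def)
  have shift: "tilt \<theta> (s + e1) = ennreal (E * exp \<theta>)" "tilt \<theta> (s - e1) = ennreal (E * exp (- \<theta>))"
    "tilt \<theta> (s - e2) = ennreal (E * exp (3 * \<theta>))" "tilt \<theta> s = ennreal E"
    by (simp_all add: tilt_def E_def e1_def e2_def exp_add[symmetric] algebra_simps)
  have m: "exp \<theta> * drift_mgf \<theta> = (exp \<theta> + exp (- \<theta>) + exp (3 * \<theta>)) / 3"
    by (simp add: drift_mgf_def distrib_left exp_add[symmetric] algebra_simps)
  show ?thesis
  proof (cases "w s")
    case True
    have "(ennreal (E * exp \<theta>) + ennreal (E * exp (- \<theta>)) + ennreal (E * exp (3 * \<theta>))) / ennreal 3 =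
        ennreal ((exp \<theta> + exp (- \<theta>) + exp (3 * \<theta>)) / 3 * E)"
      using E by (simp add: ennreal_plus[symmetric] divide_ennreal algebra_simps del: ennreal_plus ennreal_numeral)
    then show ?thesis
      using True E m drift_mgf_ge_1[of \<theta>] by (simp add: walk_op_def shift ennreal_mult[symmetric])
  next
    case False
    have "E * exp \<theta> * 1 \<le> E * exp \<theta> * drift_mgf \<theta>"
      using E drift_mgf_ge_1 by (intro mult_left_mono) auto
    then show ?thesis
      using False E drift_mgf_ge_1[of \<theta>]
      by (simp add: walk_op_def shift ennreal_mult[symmetric] ennreal_leI mult_ac)
  qed
qed

lemma walk_op_funpow_tilt: "(walk_op w ^^ n) (tilt \<theta>) s \<le> ennreal (exp \<theta> * drift_mgf \<theta>) ^ n * tilt \<theta> s"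
proof (induction n arbitrary: s)
  case (Suc n)
  let ?c = "ennreal (exp \<theta> * drift_mgf \<theta>)"
  have "(walk_op w ^^ Suc n) (tilt \<theta>) s \<le> walk_op w (\<lambda>s. ?c ^ n * tilt \<theta> s) s"
    using Suc by (auto intro: walk_op_mono)
  also have "\<dots> \<le> ?c ^ n * (?c * tilt \<theta> s)"
    unfolding walk_op_cmult by (intro mult_left_mono walk_op_tilt) auto
  finally show ?case by (simp add: mult_ac)
qed simp

text \<open>Exponential Markov inequality. The sign of \<theta> selects the tail, and the bound is
  uniform in the environment.\<close>

lemma walk_op_drift_bound:
  assumes A: "\<And>s. s \<in> A \<Longrightarrow> \<bar>\<theta>\<bar> * \<epsilon> * real n \<le> \<theta> * (real_of_int (fst s) - 3 * real_of_int (snd s) - real n)"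
  shows "(walk_op w ^^ n) (indicator A) 0 \<le> ennreal ((drift_mgf \<theta> * exp (- \<bar>\<theta>\<bar> * \<epsilon>)) ^ n)"
proof -
  let ?d = "ennreal (exp (- real n * (\<theta> + \<bar>\<theta>\<bar> * \<epsilon>)))"
  have "indicator A s \<le> ?d * tilt \<theta> s" for s
  proof (cases "s \<in> A")
    case True
    then have "0 \<le> - real n * (\<theta> + \<bar>\<theta>\<bar> * \<epsilon>) + \<theta> * (real_of_int (fst s) - 3 * real_of_int (snd s))"
      using A[of s] by (simp add: algebra_simps)
    then have "1 \<le> exp (- real n * (\<theta> + \<bar>\<theta>\<bar> * \<epsilon>)) * exp (\<theta> * (real_of_int (fst s) - 3 * real_of_int (snd s)))"
      unfolding exp_add[symmetric] by simp
    then show ?thesis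
      using True by (simp add: tilt_def ennreal_mult[symmetric])
  qed simp
  then have "(walk_op w ^^ n) (indicator A) 0 \<le> (walk_op w ^^ n) (\<lambda>s. ?d * tilt \<theta> s) 0"
    by (rule walk_op_funpow_mono)
  also have "\<dots> \<le> ?d * (ennreal (exp \<theta> * drift_mgf \<theta>) ^ n * tilt \<theta> 0)"
    unfolding walk_op_funpow_cmult by (intro mult_left_mono walk_op_funpow_tilt) auto
  also have "\<dots> = ennreal (exp (- real n * (\<theta> + \<bar>\<theta>\<bar> * \<epsilon>)) * (exp \<theta> * drift_mgf \<theta>) ^ n)"
    using drift_mgf_ge_1[of \<theta>] by (subst ennreal_power) (simp_all add: tilt_def ennreal_mult)
  finally have le: "(walk_op w ^^ n) (indicator A) 0 \<le>
      ennreal (exp (- real n * (\<theta> + \<bar>\<theta>\<bar> * \<epsilon>)) * (exp \<theta> * drift_mgf \<theta>) ^ n)" .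
  have "exp (- real n * (\<theta> + \<bar>\<theta>\<bar> * \<epsilon>)) = exp (- \<theta> + - \<bar>\<theta>\<bar> * \<epsilon>) ^ n"
    by (subst exp_of_nat_mult[symmetric]) (simp add: algebra_simps)
  moreover have "exp (- \<theta> + - \<bar>\<theta>\<bar> * \<epsilon>) * (exp \<theta> * drift_mgf \<theta>) = drift_mgf \<theta> * exp (- \<bar>\<theta>\<bar> * \<epsilon>)"
    by (subst exp_add) (simp add: exp_minus)
  ultimately show ?thesis
    using le by (simp only: power_mult_distrib[symmetric])
qed

text \<open>The increments are centred, so \<open>drift_mgf\<close> has value 1 and derivative 0 at
  0, and the exponential factor decides.\<close>

lemma drift_rate:
  assumes "0 < \<epsilon>"
  obtains \<theta> where "0 < \<theta>" "drift_mgf \<theta> * exp (- \<theta> * \<epsilon>) < 1"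
proof -
  have "((\<lambda>\<theta>. drift_mgf \<theta> * exp (- \<theta> * \<epsilon>)) has_real_derivative - \<epsilon>) (at 0)"
    unfolding drift_mgf_def[abs_def] by (auto intro!: derivative_eq_intros)
  from DERIV_neg_dec_right[OF this] assms obtain d where d: "0 < d"
    "\<And>h. 0 < h \<Longrightarrow> h < d \<Longrightarrow> drift_mgf (0 + h) * exp (- (0 + h) * \<epsilon>) < drift_mgf 0 * exp (- 0 * \<epsilon>)"
    by auto
  then have "drift_mgf (d / 2) * exp (- (d / 2) * \<epsilon>) < 1"
    using d(2)[of "d / 2"] by (simp add: drift_mgf_def)
  with d(1) show ?thesis by (intro that[of "d / 2"]) auto
qed

lemma drift_mgf_minus [simp]: "drift_mgf (- \<theta>) = drift_mgf \<theta>"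
  by (simp add: drift_mgf_def)

section \<open>Quenched and annealed marginals\<close>

fun walk_marginal :: "(site \<Rightarrow> site set) \<Rightarrow> nat \<Rightarrow> site pmf" where
  "walk_marginal G 0 = return_pmf 0"
| "walk_marginal G (Suc n) = bind_pmf (walk_marginal G n) (walk_step G)"

lemma measurable_path_component [measurable]: "(\<lambda>X. X n) \<in> path_space \<rightarrow>\<^sub>M count_space UNIV"
  by (rule measurable_component_singleton) simp

lemma space_path_space: "space path_space = UNIV"
  by (simp add: space_PiM)

lemma sets_path_Collect:
  assumes "Measurable.pred path_space P"
  shows "{X. P X} \<in> sets path_space"
  using predE[OF assms] by (simp add: space_path_space)

lemma emeasure_quenched_cylinder_snoc:
  assumes "length l = Suc n"
  shows "emeasure (quenched_law G) {X. \<forall>i<Suc (Suc n). X i = (l @ [y]) ! i} =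
    emeasure (quenched_law G) {X. \<forall>i<Suc n. X i = l ! i} * ennreal (pmf (walk_step G (l ! n)) y)"
proof -
  have "walk_kernel G i (\<lambda>j. (l @ [y]) ! j) = walk_kernel G i (\<lambda>j. l ! j)" if "i < Suc n" for i
    using that assms by (auto simp: walk_kernel_def nth_append split: nat.split)
  then have "(\<Prod>i<Suc n. ennreal (pmf (walk_kernel G i (\<lambda>j. (l @ [y]) ! j)) ((l @ [y]) ! i))) =
      (\<Prod>i<Suc n. ennreal (pmf (walk_kernel G i (\<lambda>j. l ! j)) (l ! i)))"
    using assms by (intro prod.cong) (auto simp: nth_append)
  moreover have "walk_kernel G (Suc n) (\<lambda>j. (l @ [y]) ! j) = walk_step G (l ! n)" "(l @ [y]) ! Suc n = y"
    using assms by (auto simp: walk_kernel_def nth_append)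
  ultimately show ?thesis
    unfolding emeasure_quenched_cylinder_kernel prod.lessThan_Suc[of _ "Suc n"] by simp
qed

text \<open>The construction of the law provides the probabilities of cylinders; summing over the
  countably many prefixes carries their product form over to events at later times.\<close>

lemma emeasure_quenched_prefix_sum:
  assumes [measurable]: "Measurable.pred path_space P"
  shows "emeasure (quenched_law G) {X. P X} =
    (\<integral>\<^sup>+l. emeasure (quenched_law G) ({X. \<forall>i<n. X i = l ! i} \<inter> {X. P X}) \<partial>count_space {l. length l = n})"
proof -
  let ?C = "\<lambda>l. {X. \<forall>i<n. X i = l ! i} \<inter> {X. P X}"
  have "{X. P X} = (\<Union>l\<in>{l. length l = n}. ?C l)"
  proof (intro equalityI subsetI)
    fix X assume "X \<in> {X. P X}"
    then show "X \<in> (\<Union>l\<in>{l. length l = n}. ?C l)"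
      by (intro UN_I[of "map X [0..<n]"]) auto
  qed auto
  moreover have "emeasure (quenched_law G) (\<Union>l\<in>{l. length l = n}. ?C l) =
      (\<integral>\<^sup>+l. emeasure (quenched_law G) (?C l) \<partial>count_space {l. length l = n})"
  proof (rule emeasure_UN_countable)
    show "?C l \<in> sets (quenched_law G)" for l
      unfolding sets_quenched_law by (intro sets.Int sets_path_Collect) measurable
    show "disjoint_family_on ?C {l. length l = n}"
      unfolding disjoint_family_on_def
    proof (intro ballI impI)
      fix l l' :: "site list" assume "l \<in> {l. length l = n}" "l' \<in> {l. length l = n}" "l \<noteq> l'"
      then obtain i where "i < n" "l ! i \<noteq> l' ! i"
        using nth_equalityI[of l l'] by auto
      then have "\<not> (X \<in> ?C l \<and> X \<in> ?C l')" for X by (simp, metis)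
      then show "?C l \<inter> ?C l' = {}" by blast
    qed
  qed simp
  ultimately show ?thesis by (simp only:)
qed

text \<open>The Markov property for one step. Prefixes of length \<open>Suc n\<close> are used
  because they determine the position at time \<open>n\<close>.\<close>

lemma emeasure_quenched_step:
  "emeasure (quenched_law G) {X. X n = x \<and> X (Suc n) = y} =
    emeasure (quenched_law G) {X. X n = x} * ennreal (pmf (walk_step G x) y)"
proof -
  let ?Q = "emeasure (quenched_law G)"
  let ?L = "count_space {l :: site list. length l = Suc n}"
  have "?Q {X. X n = x \<and> X (Suc n) = y} =
      (\<integral>\<^sup>+l. ?Q ({X. \<forall>i<Suc n. X i = l ! i} \<inter> {X. X n = x \<and> X (Suc n) = y}) \<partial>?L)"
    by (rule emeasure_quenched_prefix_sum) measurable
  also have "\<dots> = (\<integral>\<^sup>+l. ?Q ({X. \<forall>i<Suc n. X i = l ! i} \<inter> {X. X n = x}) * ennreal (pmf (walk_step G x) y) \<partial>?L)"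
  proof (rule nn_integral_cong)
    fix l :: "site list" assume "l \<in> space ?L"
    then have l: "length l = Suc n" by simp
    show "?Q ({X. \<forall>i<Suc n. X i = l ! i} \<inter> {X. X n = x \<and> X (Suc n) = y}) =
        ?Q ({X. \<forall>i<Suc n. X i = l ! i} \<inter> {X. X n = x}) * ennreal (pmf (walk_step G x) y)"
    proof (cases "l ! n = x")
      case True
      have "{X. \<forall>i<Suc n. X i = l ! i} \<inter> {X. X n = x \<and> X (Suc n) = y} = {X. \<forall>i<Suc (Suc n). X i = (l @ [y]) ! i}"
        "{X. \<forall>i<Suc n. X i = l ! i} \<inter> {X. X n = x} = {X. \<forall>i<Suc n. X i = l ! i}"
        using True l by (auto simp: nth_append less_Suc_eq)
      then show ?thesis
        using emeasure_quenched_cylinder_snoc[OF l, of G y] True by (simp only:)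
    next
      case False
      then have "{X. \<forall>i<Suc n. X i = l ! i} \<inter> {X. X n = x \<and> X (Suc n) = y} = {}"
        "{X. \<forall>i<Suc n. X i = l ! i} \<inter> {X. X n = x} = {}"
        by auto
      then show ?thesis by (simp only: emeasure_empty mult_zero_left)
    qed
  qed
  also have "\<dots> = (\<integral>\<^sup>+l. ?Q ({X. \<forall>i<Suc n. X i = l ! i} \<inter> {X. X n = x}) \<partial>?L) * ennreal (pmf (walk_step G x) y)"
    by (rule nn_integral_multc) simp
  also have "(\<integral>\<^sup>+l. ?Q ({X. \<forall>i<Suc n. X i = l ! i} \<inter> {X. X n = x}) \<partial>?L) = ?Q {X. X n = x}"
    by (rule emeasure_quenched_prefix_sum[symmetric]) measurable
  finally show ?thesis .
qed

lemma emeasure_quenched_point: "emeasure (quenched_law G) {X. X n = x} = ennreal (pmf (walk_marginal G n) x)"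
proof (induction n arbitrary: x)
  case 0
  have "{X. X 0 = x} = {X :: nat \<Rightarrow> site. \<forall>i<1. X i = x}" by auto
  then have "emeasure (quenched_law G) {X. X 0 = x} = ennreal (pmf (return_pmf 0) x)"
    using emeasure_quenched_cylinder_kernel[of G 1 "\<lambda>_. x"] by (simp add: walk_kernel_def)
  then show ?case by simp
next
  case (Suc n)
  let ?Q = "emeasure (quenched_law G)"
  let ?D = "\<lambda>z. {X. X n = z \<and> X (Suc n) = x}"
  have "{X. X (Suc n) = x} = (\<Union>z. ?D z)" by auto
  moreover have "?Q (\<Union>z. ?D z) = (\<integral>\<^sup>+z. ?Q (?D z) \<partial>count_space UNIV)"
  proof (rule emeasure_UN_countable)
    show "?D z \<in> sets (quenched_law G)" for z
      unfolding sets_quenched_law by (intro sets_path_Collect) measurable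
    show "disjoint_family ?D" by (auto simp: disjoint_family_on_def)
  qed simp
  ultimately have "?Q {X. X (Suc n) = x} = (\<integral>\<^sup>+z. ?Q (?D z) \<partial>count_space UNIV)" by (simp only:)
  also have "\<dots> = (\<integral>\<^sup>+z. ennreal (pmf (walk_marginal G n) z) * ennreal (pmf (walk_step G z) x) \<partial>count_space UNIV)"
    by (simp only: emeasure_quenched_step Suc.IH)
  also have "\<dots> = ennreal (pmf (walk_marginal G (Suc n)) x)"
    by (simp add: ennreal_pmf_bind nn_integral_measure_pmf)
  finally show ?case .
qed

lemma distr_quenched_marginal:
  "distr (quenched_law G) (count_space UNIV) (\<lambda>X. X n) = measure_pmf (walk_marginal G n)"
proof (rule measure_eqI_countable[of _ UNIV])
  fix x :: site
  have "(\<lambda>X. X n) -` {x} \<inter> space (quenched_law G) = {X. X n = x}"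
    using sets_eq_imp_space_eq[OF sets_quenched_law[of G]] by (auto simp: space_path_space)
  then show "emeasure (distr (quenched_law G) (count_space UNIV) (\<lambda>X. X n)) {x} = emeasure (measure_pmf (walk_marginal G n)) {x}"
    by (subst emeasure_distr) (simp_all add: emeasure_quenched_point emeasure_pmf_single)
qed auto

section \<open>The two-valued environment as a family of coins\<close>

definition step_set :: "bool \<Rightarrow> site set" where
  "step_set b = (if b then {e1, - e1, - e2} else {e1})"

lemma nn_integral_walk_step:
  "(\<integral>\<^sup>+y. f y \<partial>measure_pmf (walk_step (\<lambda>s. step_set (w s)) x)) = walk_op w f x"
proof -
  have "(\<integral>\<^sup>+y. f y \<partial>measure_pmf (walk_step (\<lambda>s. step_set (w s)) x)) =
      (\<Sum>e\<in>step_set (w x). f (x + e)) / card (step_set (w x))"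
    unfolding walk_step_def by (subst nn_integral_map_pmf, subst nn_integral_pmf_of_set) (auto simp: step_set_def)
  moreover have "card {e1, - e1, - e2} = 3" "e1 \<noteq> - e1" "e1 \<noteq> - e2" "- e1 \<noteq> - e2"
    by (auto simp: e1_def e2_def)
  moreover have "f (x + e1) / 1 = f (x + e1)" by (simp add: divide_ennreal_def)
  ultimately show ?thesis
    by (simp add: walk_op_def step_set_def add.assoc)
qed

lemma nn_integral_walk_marginal:
  "(\<integral>\<^sup>+y. f y \<partial>measure_pmf (walk_marginal (\<lambda>s. step_set (w s)) n)) = (walk_op w ^^ n) f 0"
proof (induction n arbitrary: f)
  case (Suc n)
  have "(\<integral>\<^sup>+y. f y \<partial>measure_pmf (walk_marginal (\<lambda>s. step_set (w s)) (Suc n))) = (walk_op w ^^ n) (walk_op w f) 0"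
    by (simp add: nn_integral_bind_pmf nn_integral_walk_step Suc.IH[symmetric])
  then show ?case by (simp add: funpow_Suc_right del: funpow.simps)
qed simp

lemma emeasure_quenched_law:
  "emeasure (quenched_law (\<lambda>s. step_set (w s))) {X. X n \<in> A} = (walk_op w ^^ n) (indicator A) 0"
proof -
  let ?Q = "quenched_law (\<lambda>s. step_set (w s))"
  have "(\<lambda>X. X n) -` A \<inter> space ?Q = {X. X n \<in> A}"
    using sets_eq_imp_space_eq[OF sets_quenched_law[of "\<lambda>s. step_set (w s)"]] by (auto simp: space_path_space)
  then have "emeasure ?Q {X. X n \<in> A} = emeasure (distr ?Q (count_space UNIV) (\<lambda>X. X n)) A"
    by (subst emeasure_distr) simp_all
  also have "\<dots> = (\<integral>\<^sup>+y. indicator A y \<partial>measure_pmf (walk_marginal (\<lambda>s. step_set (w s)) n))"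
    unfolding distr_quenched_marginal by simp
  finally show ?thesis by (simp only: nn_integral_walk_marginal)
qed

lemma step_set_eq_iff [simp]: "step_set b = step_set c \<longleftrightarrow> b = c"
  by (cases b; cases c) (auto simp: step_set_def e1_def e2_def)

context prob_space
begin

text \<open>The probabilities of the two admissible sets add up to 1, so almost surely no other set
  occurs and the environment is a function of i.i.d. coins.\<close>

lemma distr_random_environment:
  fixes G :: "site \<Rightarrow> 'a \<Rightarrow> site set" and p :: real
  assumes p: "0 < p" "p < 1" and indep: "indep_vars (\<lambda>_. count_space UNIV) G UNIV"
    and P: "\<And>x. \<P>(\<omega> in M. G x \<omega> = step_set True) = p" "\<And>x. \<P>(\<omega> in M. G x \<omega> = step_set False) = 1 - p"
  shows "distr M (coin_space p) (\<lambda>\<omega> x. G x \<omega> = step_set True) = coin_space p"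
    and "AE \<omega> in M. \<forall>x. G x \<omega> = step_set (G x \<omega> = step_set True)"
proof -
  let ?B = "measure_pmf (bernoulli_pmf p)"
  let ?\<xi> = "\<lambda>x \<omega>. G x \<omega> = step_set True"
  have G [measurable]: "G x \<in> M \<rightarrow>\<^sub>M count_space UNIV" for x
    using indep unfolding indep_vars_def by blast
  have meas: "?\<xi> x \<in> M \<rightarrow>\<^sub>M ?B" for x
  proof -
    have "?\<xi> x \<in> M \<rightarrow>\<^sub>M count_space UNIV" by measurable
    then show ?thesis by simp
  qed
  have ev: "{\<omega> \<in> space M. G x \<omega> = S} \<in> events" for x S by measurable
  have one: "AE \<omega> in M. G x \<omega> = step_set (?\<xi> x \<omega>)" for x
  proof -
    let ?E = "\<lambda>b. {\<omega> \<in> space M. G x \<omega> = step_set b}"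
    have "prob (?E True \<union> ?E False) = prob (?E True) + prob (?E False)"
      by (intro finite_measure_Union ev) auto
    also have "\<dots> = 1" by (simp add: P)
    finally have "AE \<omega> in M. \<omega> \<in> ?E True \<union> ?E False"
      by (intro AE_in_set_eq_1[THEN iffD2] sets.Un ev)
    then show ?thesis
    proof eventually_elim
      case (elim \<omega>)
      then consider "G x \<omega> = step_set True" | "G x \<omega> = step_set False" by blast
      then show ?case by cases simp_all
    qed
  qed
  then show "AE \<omega> in M. \<forall>x. G x \<omega> = step_set (?\<xi> x \<omega>)"
    unfolding AE_all_countable by blast
  have d: "distr M ?B (?\<xi> x) = ?B" for x
  proof (rule measure_eqI_countable[of _ UNIV])
    fix b :: bool
    have "emeasure (distr M ?B (?\<xi> x)) {b} = emeasure M (?\<xi> x -` {b} \<inter> space M)"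
      using meas by (intro emeasure_distr) auto
    also have "\<dots> = emeasure M {\<omega> \<in> space M. G x \<omega> = step_set b}"
    proof (rule emeasure_eq_AE)
      show "AE \<omega> in M. \<omega> \<in> ?\<xi> x -` {b} \<inter> space M \<longleftrightarrow> \<omega> \<in> {\<omega> \<in> space M. G x \<omega> = step_set b}"
        using one[of x]
      proof eventually_elim
        case (elim \<omega>)
        then obtain c where "G x \<omega> = step_set c" by blast
        then show ?case by (cases c) auto
      qed
      show "?\<xi> x -` {b} \<inter> space M \<in> events" using measurable_sets[OF meas] by auto
    qed (rule ev)
    also have "\<dots> = ennreal (pmf (bernoulli_pmf p) b)"
      using P[of x] p by (cases b) (simp_all add: emeasure_eq_measure)
    finally show "emeasure (distr M ?B (?\<xi> x)) {b} = emeasure ?B {b}"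
      by (simp add: emeasure_pmf_single)
  qed auto
  have "indep_vars (\<lambda>_. ?B) ?\<xi> UNIV"
    by (rule indep_vars_compose2[OF indep, of "\<lambda>_ S. S = step_set True"]) auto
  then have "distr M (PiM UNIV (\<lambda>_. ?B)) (\<lambda>\<omega>. \<lambda>x\<in>UNIV. ?\<xi> x \<omega>) = PiM UNIV (\<lambda>x. distr M ?B (?\<xi> x))"
    using meas by (subst (asm) indep_vars_iff_distr_eq_PiM) auto
  then show "distr M (coin_space p) (\<lambda>\<omega> x. ?\<xi> x \<omega>) = coin_space p"
    unfolding coin_space_def by (simp only: restrict_UNIV d)
qed

lemma emeasure_annealed_marginal:
  fixes G :: "site \<Rightarrow> 'a \<Rightarrow> site set" and p :: real
  assumes p: "0 < p" "p < 1" and indep: "indep_vars (\<lambda>_. count_space UNIV) G UNIV"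
    and P: "\<And>x. \<P>(\<omega> in M. G x \<omega> = step_set True) = p" "\<And>x. \<P>(\<omega> in M. G x \<omega> = step_set False) = 1 - p"
  shows "emeasure (annealed_law M G) {X. X n \<in> A} = (\<integral>\<^sup>+w. (walk_op w ^^ n) (indicator A) 0 \<partial>coin_space p)"
proof -
  let ?\<xi> = "\<lambda>\<omega> x. G x \<omega> = step_set True"
  note env = distr_random_environment[OF assms]
  have G [measurable]: "G x \<in> M \<rightarrow>\<^sub>M count_space UNIV" for x
    using indep unfolding indep_vars_def by blast
  have "{X. X n \<in> A} \<in> sets path_space"
    by (intro sets_path_Collect) measurable
  then have "emeasure (annealed_law M G) {X. X n \<in> A} = (\<integral>\<^sup>+\<omega>. emeasure (quenched_law (\<lambda>x. G x \<omega>)) {X. X n \<in> A} \<partial>M)"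
    by (intro emeasure_annealed_law G prob_space_axioms)
  also have "\<dots> = (\<integral>\<^sup>+\<omega>. (walk_op (?\<xi> \<omega>) ^^ n) (indicator A) 0 \<partial>M)"
  proof (rule nn_integral_cong_AE)
    show "AE \<omega> in M. emeasure (quenched_law (\<lambda>x. G x \<omega>)) {X. X n \<in> A} = (walk_op (?\<xi> \<omega>) ^^ n) (indicator A) 0"
      using env(2)
    proof eventually_elim
      case (elim \<omega>)
      then have "(\<lambda>x. G x \<omega>) = (\<lambda>x. step_set (?\<xi> \<omega> x))" by (intro HOL.ext) blast
      then show ?case using emeasure_quenched_law[of "?\<xi> \<omega>" n A] by (simp only:)
    qed
  qed
  also have "\<dots> = (\<integral>\<^sup>+w. (walk_op w ^^ n) (indicator A) 0 \<partial>distr M (coin_space p) ?\<xi>)"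
  proof (rule nn_integral_distr[symmetric])
    show "?\<xi> \<in> M \<rightarrow>\<^sub>M coin_space p"
      unfolding measurable_cong_sets[OF refl sets_coin_space] by (intro measurable_PiM_single') auto
  qed measurable
  finally show ?thesis by (simp only: env(1))
qed

end

section \<open>The law of large numbers\<close>

text \<open>Borel-Cantelli. The factor \<open>real (Suc n)\<close> makes room for a union over the n
  + 1 depths possible at time \<open>n\<close>.\<close>

lemma (in prob_space) AE_eventually_notin_geometric:
  assumes A: "\<And>n. A n \<in> events" and C: "0 \<le> C" and \<rho>: "0 \<le> \<rho>" "\<rho> < 1"
    and le: "\<And>n. emeasure M (A n) \<le> ennreal (real (Suc n) * (C * \<rho> ^ n))"
  shows "AE x in M. eventually (\<lambda>n. x \<notin> A n) sequentially"
proof -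
  have "summable (\<lambda>n. prob (A n))"
  proof (rule summable_comparison_test')
    have "summable (\<lambda>n. C * (of_nat (Suc n) * \<rho> ^ n))"
      using geometric_deriv_sums[of \<rho>] \<rho> by (intro summable_mult sums_summable) auto
    then show "summable (\<lambda>n. real (Suc n) * (C * \<rho> ^ n))"
      by (simp only: mult.left_commute)
    fix n :: nat
    have "ennreal (prob (A n)) \<le> ennreal (real (Suc n) * (C * \<rho> ^ n))"
      using le[of n] by (simp add: emeasure_eq_measure)
    then show "norm (prob (A n)) \<le> real (Suc n) * (C * \<rho> ^ n)"
      using C \<rho> by (subst (asm) ennreal_le_iff) (auto intro!: mult_nonneg_nonneg)
  qed
  then have "AE x in M. eventually (\<lambda>n. x \<in> space M - A n) sequentially"
    using A by (intro borel_cantelli_AE1) (auto simp: emeasure_eq_measure)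
  then show ?thesis
    by eventually_elim (auto elim: eventually_mono)
qed

text \<open>In \<open>n\<close> steps the walk descends by at most \<open>n\<close> rows, so only
  finitely many depths matter.\<close>

lemma walk_op_cong_strip:
  assumes "\<And>x' y'. y - int n \<le> y' \<Longrightarrow> y' \<le> y \<Longrightarrow> f (x', y') = g (x', y')"
  shows "(walk_op w ^^ n) f (x, y) = (walk_op w ^^ n) g (x, y)"
  using assms
proof (induction n arbitrary: x y)
  case (Suc n)
  then show ?case
    by (simp add: walk_op_def e1_def e2_def)
qed simp

lemma depth_deviation:
  assumes p: "0 < p" "p < 1" and \<epsilon>: "0 < \<epsilon>"
  obtains C \<rho> where "0 \<le> C" "0 \<le> \<rho>" "\<rho> < 1"
    "\<And>n. (\<integral>\<^sup>+w. (walk_op w ^^ n)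
        (indicator {s. \<epsilon> * real n < \<bar>real_of_int (snd s) + real n / velocity_time p\<bar>}) 0 \<partial>coin_space p)
      \<le> ennreal (real (Suc n) * (C * \<rho> ^ n))"
proof -
  let ?m = "velocity_time p"
  have m: "3 \<le> ?m" by (rule velocity_time_ge[OF p])
  have c: "(1 / ?m - \<epsilon>) * ?m < 1" "1 < (1 / ?m + \<epsilon>) * ?m"
    using m \<epsilon> by (simp_all add: algebra_simps)
  obtain C1 \<rho>1 where lo: "0 \<le> C1" "0 \<le> \<rho>1" "\<rho>1 < 1"
    "\<And>k n. real k \<le> (1 / ?m - \<epsilon>) * real n \<Longrightarrow> mean_depth_prob p k n \<le> ennreal (C1 * \<rho>1 ^ n)"
    using mean_depth_prob_lower_tail[OF p c(1)] by blast
  obtain C2 \<rho>2 where hi: "0 \<le> C2" "0 \<le> \<rho>2" "\<rho>2 < 1"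
    "\<And>k n. (1 / ?m + \<epsilon>) * real n \<le> real k \<Longrightarrow> mean_depth_prob p k n \<le> ennreal (C2 * \<rho>2 ^ n)"
    using mean_depth_prob_upper_tail[OF p c(2)] by blast
  define C \<rho> where "C = max C1 C2" and "\<rho> = max \<rho>1 \<rho>2"
  have C: "C1 * \<rho>1 ^ n \<le> C * \<rho> ^ n" "C2 * \<rho>2 ^ n \<le> C * \<rho> ^ n" for n
    unfolding C_def \<rho>_def using lo hi by (auto intro!: mult_mono power_mono)
  show ?thesis
  proof
    show "0 \<le> C" "0 \<le> \<rho>" "\<rho> < 1" using lo hi by (auto simp: C_def \<rho>_def)
    fix n
    let ?bad = "\<lambda>y. \<epsilon> * real n < \<bar>real_of_int y + real n / ?m\<bar>"
    have bad: "of_bool (?bad (- int k)) * mean_depth_prob p k n \<le> ennreal (C * \<rho> ^ n)" for k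
    proof (cases "?bad (- int k)")
      case True
      then consider "real k \<le> (1 / ?m - \<epsilon>) * real n" | "(1 / ?m + \<epsilon>) * real n \<le> real k"
        by (simp add: algebra_simps) linarith
      then show ?thesis
      proof cases
        case 1
        from lo(4)[OF this]
        show ?thesis using True C(1)[of n] by (auto intro: order_trans ennreal_leI)
      next
        case 2
        from hi(4)[OF this]
        show ?thesis using True C(2)[of n] by (auto intro: order_trans ennreal_leI)
      qed
    qed simp
    \<comment> \<open>Within the strip a row corresponds to exactly one depth, which turns the
      deviation event into a finite sum of depth events.\<close>
    have strip: "indicator {s. ?bad (snd s)} (x', y') =
        (\<Sum>k\<le>n. of_bool (?bad (- int k)) * indicator {0 - int k} (snd (x', y')) :: ennreal)"
      if "0 - int n \<le> y'" "y' \<le> 0" for x' y' :: int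
    proof -
      define j where "j = nat (- y')"
      have j: "y' = - int j" "j \<le> n" using that by (auto simp: j_def)
      have "(\<Sum>k\<le>n. of_bool (?bad (- int k)) * indicator {0 - int k} (snd (x', y')) :: ennreal) =
          (\<Sum>k\<le>n. if k = j then of_bool (?bad (- int j)) else 0)"
        using j(1) by (intro sum.cong) auto
      then show ?thesis using j by (simp add: indicator_def)
    qed
    have "(walk_op w ^^ n) (indicator {s. ?bad (snd s)}) 0 =
        (\<Sum>k\<le>n. of_bool (?bad (- int k)) * depth_prob w k n 0 0)" for w
    proof -
      have "(walk_op w ^^ n) (indicator {s. ?bad (snd s)}) (0, 0) =
          (walk_op w ^^ n) (\<lambda>s. \<Sum>k\<le>n. of_bool (?bad (- int k)) * indicator {0 - int k} (snd s)) (0, 0)"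
        by (rule walk_op_cong_strip) (rule strip)
      then show ?thesis
        by (simp add: walk_op_funpow_sum walk_op_funpow_cmult depth_prob_def zero_prod_def)
    qed
    then have "(\<integral>\<^sup>+w. (walk_op w ^^ n) (indicator {s. ?bad (snd s)}) 0 \<partial>coin_space p) =
        (\<Sum>k\<le>n. \<integral>\<^sup>+w. of_bool (?bad (- int k)) * depth_prob w k n 0 0 \<partial>coin_space p)"
      by (simp only:) (intro nn_integral_sum, measurable)
    also have "\<dots> = (\<Sum>k\<le>n. of_bool (?bad (- int k)) * mean_depth_prob p k n)"
      unfolding mean_depth_prob_def by (intro sum.cong refl nn_integral_cmult) measurable
    also have "\<dots> \<le> of_nat (card {..n}) * ennreal (C * \<rho> ^ n)"
      by (intro sum_bounded_above bad)
    also have "\<dots> = ennreal (real (Suc n) * (C * \<rho> ^ n))"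
    proof -
      have "ennreal (real (Suc n) * (C * \<rho> ^ n)) = ennreal (real (Suc n)) * ennreal (C * \<rho> ^ n)"
        using lo by (intro ennreal_mult) (auto simp: C_def \<rho>_def)
      then show ?thesis by (simp only: card_atMost ennreal_of_nat_eq_real_of_nat)
    qed
    finally show "(\<integral>\<^sup>+w. (walk_op w ^^ n) (indicator {s. ?bad (snd s)}) 0 \<partial>coin_space p)
      \<le> ennreal (real (Suc n) * (C * \<rho> ^ n))" .
  qed
qed

text \<open>The value \<sigma> = 1 or -1 selects the tail. The factor \<open>real (Suc n)\<close>
  brings the bound into the form that the Borel-Cantelli step expects.\<close>

lemma drift_deviation:
  assumes \<epsilon>: "0 < \<epsilon>" and \<sigma>: "\<bar>\<sigma>\<bar> = 1"
  obtains \<rho> where "0 \<le> \<rho>" "\<rho> < 1"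
    "\<And>n. (\<integral>\<^sup>+w. (walk_op w ^^ n)
        (indicator {s. \<epsilon> * real n < \<sigma> * (real_of_int (fst s) - 3 * real_of_int (snd s) - real n)}) 0 \<partial>coin_space p)
      \<le> ennreal (real (Suc n) * (1 * \<rho> ^ n))"
proof -
  interpret prob_space "coin_space p :: (site \<Rightarrow> bool) measure" by (rule prob_space_coin_space)
  obtain \<theta> where \<theta>: "0 < \<theta>" "drift_mgf \<theta> * exp (- \<theta> * \<epsilon>) < 1"
    using drift_rate[OF \<epsilon>] by blast
  let ?\<rho> = "drift_mgf \<theta> * exp (- \<theta> * \<epsilon>)"
  have \<sigma>': "\<sigma> = 1 \<or> \<sigma> = - 1" using \<sigma> by auto
  have nn: "0 \<le> ?\<rho>" using drift_mgf_ge_1[of \<theta>] by simp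
  show ?thesis
  proof (rule that[OF nn \<theta>(2)])
    fix n
    let ?A = "{s. \<epsilon> * real n < \<sigma> * (real_of_int (fst s) - 3 * real_of_int (snd s) - real n)}"
    have "(walk_op w ^^ n) (indicator ?A) 0 \<le> ennreal (?\<rho> ^ n)" for w
    proof -
      have abs: "\<bar>\<sigma> * \<theta>\<bar> = \<theta>" "drift_mgf (\<sigma> * \<theta>) = drift_mgf \<theta>" using \<sigma>' \<theta>(1) by auto
      have "\<bar>\<sigma> * \<theta>\<bar> * \<epsilon> * real n \<le> \<sigma> * \<theta> * (real_of_int (fst s) - 3 * real_of_int (snd s) - real n)" if "s \<in> ?A" for s
      proof -
        have "\<theta> * (\<epsilon> * real n) \<le> \<theta> * (\<sigma> * (real_of_int (fst s) - 3 * real_of_int (snd s) - real n))"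
          using that \<theta>(1) by (intro mult_left_mono) auto
        then show ?thesis unfolding abs by (simp only: mult_ac)
      qed
      from walk_op_drift_bound[OF this, where w = w] show ?thesis by (simp only: abs)
    qed
    then have "(\<integral>\<^sup>+w. (walk_op w ^^ n) (indicator ?A) 0 \<partial>coin_space p) \<le> (\<integral>\<^sup>+w. ennreal (?\<rho> ^ n) \<partial>(coin_space p :: (site \<Rightarrow> bool) measure))"
      by (intro nn_integral_mono)
    also have "\<dots> = ennreal (1 * ?\<rho> ^ n)"
      using emeasure_space_1 by simp
    also have "\<dots> \<le> ennreal (real (Suc n) * (1 * ?\<rho> ^ n))"
      using nn by (intro ennreal_leI) (simp add: mult_left_le distrib_right)
    finally show "(\<integral>\<^sup>+w. (walk_op w ^^ n) (indicator ?A) 0 \<partial>coin_space p) \<le> ennreal (real (Suc n) * (1 * ?\<rho> ^ n))" .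
  qed
qed

text \<open>Convergence with countable quantifiers, for the measurability of the limit
  event.\<close>

lemma LIMSEQ_inverse_Suc_iff:
  fixes f :: "nat \<Rightarrow> 'b :: metric_space"
  shows "f \<longlonglongrightarrow> c \<longleftrightarrow> (\<forall>j. \<exists>N. \<forall>n\<ge>N. dist (f n) c < inverse (real (Suc j)))"
proof
  assume R: "\<forall>j. \<exists>N. \<forall>n\<ge>N. dist (f n) c < inverse (real (Suc j))"
  show "f \<longlonglongrightarrow> c"
    unfolding lim_sequentially
  proof (intro allI impI)
    fix r :: real assume "0 < r"
    then obtain j where "inverse (real (Suc j)) < r" using reals_Archimedean by blast
    then show "\<exists>N. \<forall>n\<ge>N. dist (f n) c < r" using R by (meson less_trans)
  qed
qed (auto simp: lim_sequentially)

lemma LIMSEQ_of_deviations: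
  fixes a :: "nat \<Rightarrow> real"
  assumes "\<And>j :: nat. eventually (\<lambda>n. \<bar>a n - c * real n\<bar> \<le> inverse (real (Suc j)) * real n) sequentially"
  shows "(\<lambda>n. 1 / real n * a n) \<longlonglongrightarrow> c"
proof (rule tendstoI)
  fix r :: real assume "0 < r"
  then obtain j where j: "inverse (real (Suc j)) < r" using reals_Archimedean by blast
  show "eventually (\<lambda>n. dist (1 / real n * a n) c < r) sequentially"
    using assms[of j] eventually_gt_at_top[of 0]
  proof eventually_elim
    case (elim n)
    have "dist (1 / real n * a n) c = \<bar>a n - c * real n\<bar> / real n"
      using elim by (simp add: dist_real_def divide_simps abs_divide mult.commute)
    also have "\<dots> \<le> inverse (real (Suc j))"
      using elim by (simp only: pos_divide_le_eq of_nat_0_less_iff)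
    finally show ?case using j by simp
  qed
qed

theorem mainTheorem7:
  fixes M :: "'a measure" and G :: "site \<Rightarrow> 'a \<Rightarrow> site set" and p :: real
  assumes "0 < p" and "p < 1"
    and "prob_space M"
    and "prob_space.indep_vars M (\<lambda>_. count_space UNIV) G UNIV"
    and "\<And>x. \<P>(\<omega> in M. G x \<omega> = {e1, - e1, - e2}) = p"
    and "\<And>x. \<P>(\<omega> in M. G x \<omega> = {e1}) = 1 - p"
  shows "\<exists>v1 v2 :: real.
     \<P>(X in annealed_law M G.
        (\<lambda>n. (1 / real n) *\<^sub>R (real_of_int (fst (X n)), real_of_int (snd (X n)))) \<longlonglongrightarrow> (v1, v2)) = 1
     \<and> v2 \<noteq> 0
     \<and> - (1 / v2) = 4 - p - (5 + sqrt 5) / 2 * (1 - p)\<^sup>2 * Theta (p * gam)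
         + (1 - p) * (3 + sqrt 5 - (1 - p) * (5 + sqrt 5) * Theta p)\<^sup>2
           / ((3 + sqrt 5) * (2 - (1 - p) * (5 + sqrt 5) * Theta (p * gam)))
     \<and> v1 = 1 + 3 * v2"
proof -
  note p = assms(1,2)
  interpret M: prob_space M by fact
  note env = assms(1,2,4) and steps = assms(5,6)
  have steps': "\<P>(\<omega> in M. G x \<omega> = step_set True) = p" "\<P>(\<omega> in M. G x \<omega> = step_set False) = 1 - p" for x
    using steps[of x] by (simp_all add: step_set_def)
  note marginal = M.emeasure_annealed_marginal[OF env steps']
  have G: "G x \<in> M \<rightarrow>\<^sub>M count_space UNIV" for x
    using assms(4) unfolding M.indep_vars_def by blast
  let ?N = "annealed_law M G"
  interpret N: prob_space ?N
    by (rule prob_space_annealed_law[OF assms(3) G])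
  have sets_N: "sets ?N = sets path_space"
    by (rule sets_annealed_law[OF assms(3) G])
  have space_N: "space ?N = UNIV"
    using sets_eq_imp_space_eq[OF sets_N] by (simp add: space_path_space)
  have event: "{X. X n \<in> A} \<in> N.events" for n A
    unfolding sets_N by (intro sets_path_Collect) measurable
  have BC: "AE X in ?N. eventually (\<lambda>n. X n \<notin> A n) sequentially"
    if "0 \<le> C" "0 \<le> \<rho>" "\<rho> < 1"
      "\<And>n. (\<integral>\<^sup>+w. (walk_op w ^^ n) (indicator (A n)) 0 \<partial>coin_space p) \<le> ennreal (real (Suc n) * (C * \<rho> ^ n))"
    for A :: "nat \<Rightarrow> site set" and C \<rho>
    using N.AE_eventually_notin_geometric[of "\<lambda>n. {X. X n \<in> A n}", OF event that(1-3)] that(4) marginal by simp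
  define m where "m = velocity_time p"
  have m: "3 \<le> m" unfolding m_def by (rule velocity_time_ge[OF p])
  define v2 v1 where "v2 = - (1 / m)" and "v1 = 1 + 3 * v2"
  let ?x = "\<lambda>X n. real_of_int (fst (X n :: site))" and ?y = "\<lambda>X n. real_of_int (snd (X n :: site))"
  have "AE X in ?N. eventually (\<lambda>n. \<bar>?y X n - v2 * real n\<bar> \<le> inverse (real (Suc j)) * real n) sequentially" for j
  proof -
    have "0 < inverse (real (Suc j))" by simp
    from depth_deviation[OF p this] obtain C \<rho> where "0 \<le> C" "0 \<le> \<rho>" "\<rho> < 1"
      "\<And>n. (\<integral>\<^sup>+w. (walk_op w ^^ n)
        (indicator {s. inverse (real (Suc j)) * real n < \<bar>real_of_int (snd s) + real n / velocity_time p\<bar>}) 0 \<partial>coin_space p)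
      \<le> ennreal (real (Suc n) * (C * \<rho> ^ n))" by blast
    from BC[OF this] show ?thesis
      by (simp add: v2_def m_def not_less)
  qed
  then have "AE X in ?N. \<forall>j. eventually (\<lambda>n. \<bar>?y X n - v2 * real n\<bar> \<le> inverse (real (Suc j)) * real n) sequentially"
    unfolding AE_all_countable by blast
  then have lim_y: "AE X in ?N. (\<lambda>n. 1 / real n * ?y X n) \<longlonglongrightarrow> v2"
    by eventually_elim (intro LIMSEQ_of_deviations, blast)
  let ?z = "\<lambda>X n. ?x X n - 3 * ?y X n - real n"
  have dev: "AE X in ?N. eventually (\<lambda>n. \<sigma> * ?z X n \<le> inverse (real (Suc j)) * real n) sequentially"
    if "\<bar>\<sigma>\<bar> = 1" for j \<sigma>
  proof -
    have "0 < inverse (real (Suc j))" by simp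
    from drift_deviation[OF this that] obtain \<rho> where "0 \<le> \<rho>" "\<rho> < 1"
      "\<And>n. (\<integral>\<^sup>+w. (walk_op w ^^ n) (indicator {s. inverse (real (Suc j)) * real n <
          \<sigma> * (real_of_int (fst s) - 3 * real_of_int (snd s) - real n)}) 0 \<partial>coin_space p)
      \<le> ennreal (real (Suc n) * (1 * \<rho> ^ n))" by blast
    from BC[OF zero_le_one this] show ?thesis
      by (simp add: not_less)
  qed
  have "AE X in ?N. eventually (\<lambda>n. \<bar>?z X n - 0 * real n\<bar> \<le> inverse (real (Suc j)) * real n) sequentially" for j
    using dev[of 1 j, simplified] dev[of "- 1" j, simplified]
  proof eventually_elim
    case (elim X)
    then show ?case by eventually_elim (simp add: abs_le_iff)
  qed
  then have "AE X in ?N. \<forall>j. eventually (\<lambda>n. \<bar>?z X n - 0 * real n\<bar> \<le> inverse (real (Suc j)) * real n) sequentially"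
    unfolding AE_all_countable by blast
  then have lim_z: "AE X in ?N. (\<lambda>n. 1 / real n * ?z X n) \<longlonglongrightarrow> 0"
    by eventually_elim (intro LIMSEQ_of_deviations, blast)
  let ?lim = "\<lambda>X. (\<lambda>n. (1 / real n) *\<^sub>R (?x X n, ?y X n)) \<longlonglongrightarrow> (v1, v2)"
  have "AE X in ?N. ?lim X"
    using lim_y lim_z
  proof eventually_elim
    case (elim X)
    have "(\<lambda>n. 1 + 3 * (1 / real n * ?y X n) + 1 / real n * ?z X n) \<longlonglongrightarrow> 1 + 3 * v2 + 0"
      using elim by (intro tendsto_intros)
    \<comment> \<open>For n > 0 the first coordinate is recovered from x = n + 3 y + z, with z the
      centred combination \<open>?z\<close>; this is where 1 + 3 \<open>v2\<close> comes
      from.\<close>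
    moreover have "eventually (\<lambda>n. 1 + 3 * (1 / real n * ?y X n) + 1 / real n * ?z X n = 1 / real n * ?x X n) sequentially"
      using eventually_gt_at_top[of 0] by eventually_elim (simp add: field_simps)
    ultimately have "(\<lambda>n. 1 / real n * ?x X n) \<longlonglongrightarrow> v1"
      unfolding v1_def by (simp add: tendsto_cong)
    from tendsto_Pair[OF this elim(1)] show ?case by simp
  qed
  moreover have "{X \<in> space ?N. ?lim X} \<in> N.events"
  proof -
    have "Measurable.pred path_space (\<lambda>X. dist ((1 / real n) *\<^sub>R (?x X n, ?y X n)) (v1, v2) < r)" for n r
      by (rule measurable_compose[OF measurable_path_component[of n],
            of "\<lambda>s. dist ((1 / real n) *\<^sub>R (real_of_int (fst s), real_of_int (snd s))) (v1, v2) < r"]) simp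
    then show ?thesis
      unfolding space_N sets_N LIMSEQ_inverse_Suc_iff
      using sets_path_Collect[of "\<lambda>X. \<forall>j. \<exists>N. \<forall>n\<ge>N. dist ((1 / real n) *\<^sub>R (?x X n, ?y X n)) (v1, v2) < inverse (real (Suc j))"]
      by simp
  qed
  ultimately have "\<P>(X in ?N. ?lim X) = 1"
    by (simp add: N.prob_Collect_eq_1)
  moreover have "v2 \<noteq> 0" using m by (simp add: v2_def)
  moreover have "- (1 / v2) = velocity_time p" by (simp add: v2_def m_def)
  ultimately show ?thesis
    unfolding velocity_time_def v1_def by blast
qed

end
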